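(* Let $\mu,\nu$ be compositions of $n$ with $\nu$ refining $\mu$, and let $\pi\in\mathcal{I}_\mu$. Then \[ \mathfrak{S}^\mu_\pi=\sum_{\tau\in\mathcal{I}_\nu,\ \tau\le_{\mathcal{A}}\pi}\mathfrak{S}^\nu_\tau . \]
   Context: A composition $\mu=(\mu_1,\dots,\mu_k)$ of $n$ has positive integer parts summing to $n$; $\nu$ refines $\mu$ if $\{\sum_{i\le j}\nu_i\}_j\supseteq\{\sum_{i\le j}\mu_i\}_j$. Permutations are in one-line notation; $\mathrm{std}$ is standardization. $\ell$ is Coxeter length, $s_i=(i,i{+}1)$, $e$ the identity, $w_0=n\cdots 21$, and the 0--Hecke product is $w\circ s_i=ws_i$ if $\ell(ws_i)>\ell(w)$, else $w$ (similarly on the left). For $\pi\in S_n$ and $m_r=\mu_1+\dots+\mu_{r-1}$, the $r$th block is $B_r=\pi(m_r{+}1)\cdots\pi(m_r{+}\mu_r)$; $\pi$ is a $\mu$--involution ($\pi\in\mathcal{I}_\mu$) if each $\mathrm{std}(B_r)$ is an involution. For $\pi\in\mathcal{I}_\mu$, $i\in[n-1]$: if values $i,i{+}1$ are in different blocks, $\pi\circ_\mu s_i=s_i\circ\pi$; if they are in the same block $B$, replace $B$ by the word on the same values with standardization $s_r\circ\mathrm{std}(B)\circ s_r$, where $i$ is the $r$th smallest value of $B$. This extends to a right action of the 0--Hecke monoid. $\ell_\mu(\pi)$ is the minimal $p$ with $\pi=e\circ_\mu s_{a_1}\circ_\mu\cdots\circ_\mu s_{a_p}$; $\mathcal{A}_\mu(\pi)=\{w\in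 S_n:e\circ_\mu w=\pi,\ \ell(w)=\ell_\mu(\pi)\}$. Schubert polynomials: with $\partial_i f=(f-s_if)/(x_i-x_{i+1})$ ($s_i$ swapping $x_i,x_{i+1}$), $\mathfrak{S}_{w_0}=x_1^{n-1}x_2^{n-2}\cdots x_{n-1}$ and $\mathfrak{S}_w=\partial_i\mathfrak{S}_{ws_i}$ when $w(i)<w(i{+}1)$. The $\mu$--involution Schubert polynomial is $\mathfrak{S}^\mu_\pi=\sum_{w\in\mathcal{A}_\mu(\pi)}\mathfrak{S}_w$. For $\tau\in\mathcal{I}_\nu$ and $\pi\in\mathcal{I}_\mu$, write $\tau\le_{\mathcal{A}}\pi$ if $\nu$ refines $\mu$ and $\mathcal{A}_\nu(\tau)\subseteq\mathcal{A}_\mu(\pi)$. *)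

theory Defs
  imports "HOL-Library.Poly_Mapping" "HOL-Combinatorics.Permutations"
begin

text \<open>
  Permutations of \<open>[n]\<close> are functions \<open>w\<close> on \<^typ>\<open>nat\<close> with \<open>w permutes {1..n}\<close>; the one-line
  word of \<open>w\<close> is \<open>w 1, ..., w n\<close>.  A word in the generators is a list with entries
  in \<open>{1..<n}\<close>, an entry \<open>i\<close> standing for \<open>sref i\<close>.
\<close>

section \<open>Compositions\<close>

definition composition :: "nat \<Rightarrow> nat list \<Rightarrow> bool" where
  "composition n \<mu> \<longleftrightarrow> (\<forall>k\<in>set \<mu>. 0 < k) \<and> sum_list \<mu> = n"

definition partial_sums :: "nat list \<Rightarrow> nat set" where
  "partial_sums \<mu> = (\<lambda>j. sum_list (take j \<mu>)) ` {1..length \<mu>}"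

definition refines :: "nat list \<Rightarrow> nat list \<Rightarrow> bool" where
  "refines \<nu> \<mu> \<longleftrightarrow> partial_sums \<mu> \<subseteq> partial_sums \<nu>"


section \<open>Coxeter length and the 0-Hecke product\<close>

abbreviation sref :: "nat \<Rightarrow> nat \<Rightarrow> nat" where
  "sref i \<equiv> transpose i (Suc i)"

definition coxeter_length :: "nat \<Rightarrow> (nat \<Rightarrow> nat) \<Rightarrow> nat" where
  "coxeter_length n w =
     (LEAST p. \<exists>a. length a = p \<and> set a \<subseteq> {1..<n} \<and> foldl (\<lambda>u i. u \<circ> sref i) id a = w)"

definition hecke_right :: "nat \<Rightarrow> (nat \<Rightarrow> nat) \<Rightarrow> nat \<Rightarrow> (nat \<Rightarrow> nat)" where
  "hecke_right n w i =
     (if coxeter_length n (w \<circ> sref i) > coxeter_length n w then w \<circ> sref i else w)"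

definition hecke_left :: "nat \<Rightarrow> nat \<Rightarrow> (nat \<Rightarrow> nat) \<Rightarrow> (nat \<Rightarrow> nat)" where
  "hecke_left n i w =
     (if coxeter_length n (sref i \<circ> w) > coxeter_length n w then sref i \<circ> w else w)"

definition hecke_word :: "nat \<Rightarrow> nat list \<Rightarrow> (nat \<Rightarrow> nat)" where
  "hecke_word n a = foldl (hecke_right n) id a"


section \<open>Blocks and \<open>\<mu>\<close>-involutions\<close>

text \<open>Blocks are numbered from 0, positions and values from 1.\<close>

definition block_start :: "nat list \<Rightarrow> nat \<Rightarrow> nat" where
  "block_start \<mu> r = sum_list (take r \<mu>)"

definition block :: "nat list \<Rightarrow> (nat \<Rightarrow> nat) \<Rightarrow> nat \<Rightarrow> nat list" where
  "block \<mu> \<pi> r = map (\<lambda>j. \<pi> (block_start \<mu> r + j)) [1..<Suc (\<mu> ! r)]"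

text \<open>Standardization of a word with distinct letters, as a permutation of \<open>{1..length B}\<close>.\<close>

definition std :: "nat list \<Rightarrow> nat \<Rightarrow> nat" where
  "std B j = (if j \<in> {1..length B} then card {v \<in> set B. v \<le> B ! (j - 1)} else j)"

definition mu_involutions :: "nat \<Rightarrow> nat list \<Rightarrow> (nat \<Rightarrow> nat) set" where
  "mu_involutions n \<mu> =
     {\<pi>. \<pi> permutes {1..n} \<and> (\<forall>r<length \<mu>. std (block \<mu> \<pi> r) \<circ> std (block \<mu> \<pi> r) = id)}"

definition block_of :: "nat list \<Rightarrow> (nat \<Rightarrow> nat) \<Rightarrow> nat \<Rightarrow> nat" where
  "block_of \<mu> \<pi> v = (THE r. r < length \<mu> \<and> v \<in> set (block \<mu> \<pi> r))"

text \<open>The word on the set of values \<open>V\<close> with standardization \<open>\<sigma>\<close>.\<close>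

definition unstd :: "nat set \<Rightarrow> (nat \<Rightarrow> nat) \<Rightarrow> nat list" where
  "unstd V \<sigma> = map (\<lambda>j. sorted_list_of_set V ! (\<sigma> j - 1)) [1..<Suc (card V)]"

definition replace_block :: "nat list \<Rightarrow> (nat \<Rightarrow> nat) \<Rightarrow> nat \<Rightarrow> nat list \<Rightarrow> (nat \<Rightarrow> nat)" where
  "replace_block \<mu> \<pi> r B = (\<lambda>p.
     if p \<in> {block_start \<mu> r + 1..block_start \<mu> r + \<mu> ! r}
     then B ! (p - block_start \<mu> r - 1) else \<pi> p)"


section \<open>The 0-Hecke action on \<open>\<mu>\<close>-involutions\<close>

text \<open>Below, \<open>k\<close> is the rank of the value \<open>i\<close> in its block \<open>B\<close>.\<close>

definition mu_act :: "nat \<Rightarrow> nat list \<Rightarrow> (nat \<Rightarrow> nat) \<Rightarrow> nat \<Rightarrow> (nat \<Rightarrow> nat)" where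
  "mu_act n \<mu> \<pi> i =
     (let r = block_of \<mu> \<pi> i; B = block \<mu> \<pi> r; k = card {v \<in> set B. v \<le> i}; b = length B
      in if block_of \<mu> \<pi> (Suc i) \<noteq> r then hecke_left n i \<pi>
         else replace_block \<mu> \<pi> r
                (unstd (set B) (hecke_right b (hecke_left b k (std B)) k)))"

definition mu_act_word :: "nat \<Rightarrow> nat list \<Rightarrow> (nat \<Rightarrow> nat) \<Rightarrow> nat list \<Rightarrow> (nat \<Rightarrow> nat)" where
  "mu_act_word n \<mu> \<pi> a = foldl (mu_act n \<mu>) \<pi> a"

text \<open>
  The action of \<open>w\<close>: act by the letters of any word whose 0-Hecke product is \<open>w\<close>.  That the
  result does not depend on the word is the statement that the action of the generators extends
  to the 0-Hecke monoid.
\<close>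

definition mu_act_perm :: "nat \<Rightarrow> nat list \<Rightarrow> (nat \<Rightarrow> nat) \<Rightarrow> (nat \<Rightarrow> nat) \<Rightarrow> (nat \<Rightarrow> nat)" where
  "mu_act_perm n \<mu> \<pi> w =
     (THE \<rho>. \<exists>a. set a \<subseteq> {1..<n} \<and> hecke_word n a = w \<and> mu_act_word n \<mu> \<pi> a = \<rho>)"

definition mu_length :: "nat \<Rightarrow> nat list \<Rightarrow> (nat \<Rightarrow> nat) \<Rightarrow> nat" where
  "mu_length n \<mu> \<pi> =
     (LEAST p. \<exists>a. length a = p \<and> set a \<subseteq> {1..<n} \<and> mu_act_word n \<mu> id a = \<pi>)"

definition atoms :: "nat \<Rightarrow> nat list \<Rightarrow> (nat \<Rightarrow> nat) \<Rightarrow> (nat \<Rightarrow> nat) set" where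
  "atoms n \<mu> \<pi> =
     {w. w permutes {1..n} \<and> mu_act_perm n \<mu> id w = \<pi> \<and> coxeter_length n w = mu_length n \<mu> \<pi>}"

definition atom_le :: "nat \<Rightarrow> nat list \<Rightarrow> nat list \<Rightarrow> (nat \<Rightarrow> nat) \<Rightarrow> (nat \<Rightarrow> nat) \<Rightarrow> bool" where
  "atom_le n \<nu> \<mu> \<tau> \<pi> \<longleftrightarrow> refines \<nu> \<mu> \<and> atoms n \<nu> \<tau> \<subseteq> atoms n \<mu> \<pi>"


section \<open>Schubert polynomials\<close>

text \<open>Integer polynomials in variables indexed by \<^typ>\<open>nat\<close>: maps from exponent vectors to coefficients.\<close>

type_synonym int_mpoly = "(nat \<Rightarrow>\<^sub>0 nat) \<Rightarrow>\<^sub>0 int"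

definition X :: "nat \<Rightarrow> int_mpoly" where
  "X i = Poly_Mapping.single (Poly_Mapping.single i 1) 1"

text \<open>
  Exchange of the variables \<open>i\<close> and \<open>Suc i\<close>: \<^const>\<open>Poly_Mapping.map_key\<close> precomposes with an
  injective map, here first on exponent vectors and then on polynomials.
\<close>

definition var_swap :: "nat \<Rightarrow> int_mpoly \<Rightarrow> int_mpoly" where
  "var_swap i = Poly_Mapping.map_key (Poly_Mapping.map_key (sref i))"

text \<open>
  The quotient of \<open>f - var_swap i f\<close> by \<open>X i - X (Suc i)\<close>; it exists and is unique,
  see \<open>divided_difference_eq\<close> below.
\<close>

definition divided_difference :: "nat \<Rightarrow> int_mpoly \<Rightarrow> int_mpoly" where
  "divided_difference i f = (THE g. (X i - X (Suc i)) * g = f - var_swap i f)"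

definition longest :: "nat \<Rightarrow> nat \<Rightarrow> nat" where
  "longest n i = (if i \<in> {1..n} then n + 1 - i else i)"

inductive is_schubert :: "nat \<Rightarrow> (nat \<Rightarrow> nat) \<Rightarrow> int_mpoly \<Rightarrow> bool" for n where
  longest: "is_schubert n (longest n) (\<Prod>i\<in>{1..<n}. X i ^ (n - i))"
| step: "w permutes {1..n} \<Longrightarrow> i \<in> {1..<n} \<Longrightarrow> w i < w (Suc i) \<Longrightarrow> is_schubert n (w \<circ> sref i) f
    \<Longrightarrow> is_schubert n w (divided_difference i f)"

text \<open>
  The recursion allows any ascent of \<open>w\<close> at each step; the resulting polynomial is the same
  for all choices because the divided differences satisfy the braid relations.
\<close>

definition schubert :: "nat \<Rightarrow> (nat \<Rightarrow> nat) \<Rightarrow> int_mpoly" where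
  "schubert n w = (THE f. is_schubert n w f)"

definition mu_schubert :: "nat \<Rightarrow> nat list \<Rightarrow> (nat \<Rightarrow> nat) \<Rightarrow> int_mpoly" where
  "mu_schubert n \<mu> \<pi> = (\<Sum>w\<in>atoms n \<mu> \<pi>. schubert n w)"


subsection \<open>Divided differences are well defined\<close>

lemma inj_sref: "inj (sref i)"
  by (metis bij_betw_def bij_swap_iff bij_transpose)

lemma map_key_sref_sref: "Poly_Mapping.map_key (sref i) (Poly_Mapping.map_key (sref i) m) = m"
  by (rule poly_mapping_eqI) (simp add: map_key.rep_eq inj_sref)

lemma inj_map_key_sref: "inj (Poly_Mapping.map_key (sref i) :: (nat \<Rightarrow>\<^sub>0 nat) \<Rightarrow> _)"
  by (rule inj_on_inverseI[where g = "Poly_Mapping.map_key (sref i)"]) (simp add: map_key_sref_sref)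

lemma var_swap_add: "var_swap i (f + g) = var_swap i f + var_swap i g"
  unfolding var_swap_def by (rule map_key_plus[OF inj_map_key_sref])

lemma var_swap_single:
  "var_swap i (Poly_Mapping.single m c) = Poly_Mapping.single (Poly_Mapping.map_key (sref i) m) c"
  unfolding var_swap_def
  by (metis map_key_single[OF inj_map_key_sref] map_key_sref_sref)

lemma var_swap_X: "var_swap i (X j) = X (sref i j)"
  unfolding X_def var_swap_single
  by (metis map_key_single[OF inj_sref] transpose_involutory)

lemma single_induct [case_names zero add]:
  fixes f :: "'a \<Rightarrow>\<^sub>0 'b :: comm_monoid_add"
  assumes "P 0" and "\<And>m c g. P g \<Longrightarrow> P (Poly_Mapping.single m c + g)"
  shows "P f"
proof (induction f rule: update_induct)
  case const
  show ?case by (rule assms(1))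
next
  case (update f a b)
  have "Poly_Mapping.update a b f = Poly_Mapping.single a b + f"
    using update by (intro poly_mapping_eqI)
      (auto simp: lookup_update lookup_add lookup_single in_keys_iff when_def)
  then show ?case using assms(2) update by simp
qed

lemma single_dvd_swap:
  "(X i - X (Suc i)) dvd Poly_Mapping.single m c - var_swap i (Poly_Mapping.single m c)"
proof -
  define d where "d = X i - X (Suc i)"
  have mult: "d dvd Poly_Mapping.single (m + m') (c * c')
      - var_swap i (Poly_Mapping.single (m + m') (c * c'))"
    if "d dvd Poly_Mapping.single m c - var_swap i (Poly_Mapping.single m c)"
      and "d dvd Poly_Mapping.single m' c' - var_swap i (Poly_Mapping.single m' c')"
    for m m' :: "nat \<Rightarrow>\<^sub>0 nat" and c c' :: int
  proof -
    let ?f = "Poly_Mapping.single m c" and ?g = "Poly_Mapping.single m' c'"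
    have "?f * ?g - var_swap i (?f * ?g)
        = (?f - var_swap i ?f) * ?g + var_swap i ?f * (?g - var_swap i ?g)"
      by (simp add: mult_single var_swap_single map_key_plus[OF inj_sref] algebra_simps)
    then show ?thesis using that by (simp add: mult_single)
  qed
  have X: "d dvd Poly_Mapping.single (Poly_Mapping.single j 1) 1
      - var_swap i (Poly_Mapping.single (Poly_Mapping.single j 1) 1)" for j
  proof -
    have "X (Suc i) - X i = - d" by (simp add: d_def)
    then have "d dvd X j - X (sref i j)"
      by (auto simp: transpose_def d_def[symmetric])
    then show ?thesis using var_swap_X[of i j] by (simp add: X_def)
  qed
  have C: "d dvd Poly_Mapping.single 0 c - var_swap i (Poly_Mapping.single 0 c)" for c
    by (simp add: var_swap_single map_key_zero[OF inj_sref])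
  have pow: "d dvd Poly_Mapping.single (Poly_Mapping.single j k) 1
      - var_swap i (Poly_Mapping.single (Poly_Mapping.single j k) 1)" for j k
  proof (induction k)
    case 0
    show ?case using C[of 1] by simp
  next
    case (Suc k)
    then show ?case using mult[OF X[of j] Suc] by (simp flip: single_add)
  qed
  have "d dvd Poly_Mapping.single m 1 - var_swap i (Poly_Mapping.single m 1)"
  proof (induction m rule: single_induct)
    case zero
    show ?case by (rule C)
  next
    case (add j k m)
    then show ?case using mult[OF pow[of j k] add] by simp
  qed
  from mult[OF C[of c] this] show ?thesis by (simp add: d_def)
qed

lemma X_diff_nonzero: "X i - X (Suc i) \<noteq> 0"
proof
  assume "X i - X (Suc i) = 0"
  then have "Poly_Mapping.lookup (X i) (Poly_Mapping.single i 1)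
      = Poly_Mapping.lookup (X (Suc i)) (Poly_Mapping.single i 1)" by simp
  then show False
    by (simp add: X_def lookup_single when_def split: if_splits)
       (metis lookup_single_eq lookup_single_not_eq n_not_Suc_n zero_neq_one)
qed

lemma divided_difference_eq: "(X i - X (Suc i)) * divided_difference i f = f - var_swap i f"
proof -
  have "(X i - X (Suc i)) dvd f - var_swap i f"
  proof (induction f rule: single_induct)
    case zero
    show ?case by (simp add: var_swap_def map_key_zero[OF inj_map_key_sref])
  next
    case (add m c g)
    from dvd_add[OF single_dvd_swap[of i m c] add] show ?case
      by (simp add: var_swap_add algebra_simps)
  qed
  then obtain g where "(X i - X (Suc i)) * g = f - var_swap i f"
    by (metis dvdE)
  then have "\<exists>!g. (X i - X (Suc i)) * g = f - var_swap i f"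
    using X_diff_nonzero[of i] by (metis mult_left_cancel)
  then show ?thesis
    unfolding divided_difference_def by (rule theI')
qed

end

(* The action on \<mu>-involutions is two-sided multiplication in the 0-Hecke monoid: the letter i sorts
   the values i, i+1 (lmul) and, when these lie in the same block, afterwards also the positions that
   they occupy once each block is sorted (rmul).  Sorting values commutes with sorting positions, so
   two position words that agree on the identity agree on every permutation (foldl_rmul_cong).

   Colour each value by the index of its block.  If \<nu> refines \<mu>, then running the same word in both
   actions keeps the \<mu>-state equal to the \<nu>-state multiplied on the right (0-Hecke product) by the
   permutation inv (rank of \<mu>-colours) followed by (rank of \<nu>-colours), which is a function of
   the \<nu>-state alone.  Hence words with equal \<nu>-result have equal \<mu>-result.  For \<nu> = (1,...,1) this
   says that the action of the 0-Hecke monoid is well defined.  Since the atoms of a state are the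
   elements of minimal length in its fibre, and \<nu>-fibres are contained in \<mu>-fibres, the atoms of \<pi> are
   the disjoint union of the atom sets contained in them. *)

theory Submission
  imports Defs
begin

section \<open>Sorting adjacent values and adjacent positions\<close>

text \<open>The length test of the 0-Hecke product is replaced by a comparison of two entries. The
  parameter n disappears, and commutation with \<open>lmul\<close> can be proved for arbitrary
  bijections; \<open>hecke_right_eq\<close> restores the link.\<close>

definition rmul :: "(nat \<Rightarrow> nat) \<Rightarrow> nat \<Rightarrow> (nat \<Rightarrow> nat)" where
  "rmul w j = (if w j < w (Suc j) then w \<circ> sref j else w)"

definition lmul :: "nat \<Rightarrow> (nat \<Rightarrow> nat) \<Rightarrow> (nat \<Rightarrow> nat)" where
  "lmul i w = (if inv w i < inv w (Suc i) then sref i \<circ> w else w)"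

lemma bij_sref: "bij (sref i)"
  by simp

lemma sref_comp_sref [simp]: "sref i \<circ> sref i = id" "sref i \<circ> (sref i \<circ> f) = f"
  by (auto simp: fun_eq_iff)

lemma sref_permutes: "i \<in> {1..<n} \<Longrightarrow> sref i permutes {1..n}"
  by (rule permutes_swap_id) auto

lemmas sref_permutes' [simp] = sref_permutes[simplified]

lemma permutes_ident [simp]: "(\<lambda>x. x) permutes A"
  by (simp add: permutes_def)

lemma inv_comp_sref: "bij w \<Longrightarrow> inv (w \<circ> sref i) = sref i \<circ> inv w"
  by (simp add: o_inv_distrib)

lemma inv_sref_comp: "bij w \<Longrightarrow> inv (sref i \<circ> w) = inv w \<circ> sref i"
  by (simp add: o_inv_distrib)

lemma bij_rmul: "bij w \<Longrightarrow> bij (rmul w j)"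
  by (simp add: rmul_def bij_comp)

lemma bij_lmul: "bij w \<Longrightarrow> bij (lmul i w)"
  by (simp add: lmul_def bij_comp)

lemma rmul_permutes: "w permutes {1..n} \<Longrightarrow> j \<in> {1..<n} \<Longrightarrow> rmul w j permutes {1..n}"
  using permutes_compose[OF sref_permutes] by (simp add: rmul_def)

lemma lmul_permutes: "w permutes {1..n} \<Longrightarrow> i \<in> {1..<n} \<Longrightarrow> lmul i w permutes {1..n}"
  using permutes_compose[OF _ sref_permutes] by (simp add: lmul_def)

lemma foldl_rmul_permutes:
  "w permutes {1..n} \<Longrightarrow> set e \<subseteq> {1..<n} \<Longrightarrow> foldl rmul w e permutes {1..n}"
  by (induction e arbitrary: w) (use rmul_permutes in auto)

lemma inv_rmul: "bij w \<Longrightarrow> inv (rmul w j) = lmul j (inv w)"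
  by (simp add: rmul_def lmul_def inv_comp_sref inv_inv_eq)

lemma sref_less_iff:
  assumes "\<not> (x = j \<and> y = Suc j)" "\<not> (x = Suc j \<and> y = j)"
  shows "sref j x < sref j y \<longleftrightarrow> x < y"
  using assms by (auto simp: transpose_def)

lemma comp_sref_eq_sref_comp:
  assumes "bij w" "w j = i" "w (Suc j) = Suc i"
  shows "w \<circ> sref j = sref i \<circ> w"
proof
  fix x
  have "w x = w y \<longleftrightarrow> x = y" for y
    using assms(1) by (simp add: bij_def inj_eq)
  from this[of j] this[of "Suc j"] show "(w \<circ> sref j) x = (sref i \<circ> w) x"
    using assms by (auto simp: transpose_def)
qed

text \<open>One swap can affect the other test only if w maps {j, Suc j} onto {i, Suc i}. If w is
  increasing there, both swaps have the same effect and the second one no longer acts; if it is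
  decreasing, neither acts. In all other cases each test is blind to the other swap.\<close>

lemma lmul_rmul:
  assumes w: "bij w"
  shows "lmul i (rmul w j) = rmul (lmul i w) j"
proof -
  have inj: "w x = w y \<longleftrightarrow> x = y" for x y
    using w by (simp add: bij_def inj_eq)
  have iw: "inv w (w x) = x" "w (inv w x) = x" for x
    using w by (simp_all add: bij_def surj_f_inv_f)
  consider "w j = i \<and> w (Suc j) = Suc i" | "w j = Suc i \<and> w (Suc j) = i"
    | "\<not> (w j = i \<and> w (Suc j) = Suc i)" "\<not> (w j = Suc i \<and> w (Suc j) = i)" by blast
  then show ?thesis
  proof cases
    case 1
    then have e: "w \<circ> sref j = sref i \<circ> w" using comp_sref_eq_sref_comp[OF w] by simp
    from 1 have "inv w i = j" "inv w (Suc i) = Suc j" using iw by metis+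
    then show ?thesis using 1 e
      by (simp add: lmul_def rmul_def inv_sref_comp[OF w])
  next
    case 2
    then have "inv w i = Suc j" "inv w (Suc i) = j" using iw(1)[of j] iw(1)[of "Suc j"] by simp_all
    then show ?thesis using 2 by (simp add: lmul_def rmul_def)
  next
    case 3
    then have 4: "\<not> (inv w i = j \<and> inv w (Suc i) = Suc j)" "\<not> (inv w i = Suc j \<and> inv w (Suc i) = j)"
      using iw by metis+
    have "inv (w \<circ> sref j) i < inv (w \<circ> sref j) (Suc i) \<longleftrightarrow> inv w i < inv w (Suc i)"
      unfolding inv_comp_sref[OF w] using sref_less_iff[of "inv w i" j "inv w (Suc i)"] 4 by auto
    moreover have "(sref i \<circ> w) j < (sref i \<circ> w) (Suc j) \<longleftrightarrow> w j < w (Suc j)"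
      using sref_less_iff[of "w j" i "w (Suc j)"] 3 by auto
    ultimately show ?thesis by (simp add: lmul_def rmul_def comp_assoc)
  qed
qed

lemma lmul_foldl_rmul: "bij w \<Longrightarrow> lmul i (foldl rmul w e) = foldl rmul (lmul i w) e"
  by (induction e arbitrary: w) (simp_all add: lmul_rmul bij_rmul)


section \<open>Inversions and reduced words\<close>

definition inversions :: "nat \<Rightarrow> (nat \<Rightarrow> nat) \<Rightarrow> (nat \<times> nat) set" where
  "inversions n w = {(a, b). a \<in> {1..n} \<and> b \<in> {1..n} \<and> a < b \<and> w b < w a}"

lemma inversions_ident [simp]: "inversions n (\<lambda>x. x) = {}" "inversions n id = {}"
  by (auto simp: inversions_def)

lemma finite_inversions: "finite (inversions n w)"
  by (rule finite_subset[of _ "{1..n} \<times> {1..n}"]) (auto simp: inversions_def)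

text \<open>Moving both positions by the transposition matches the inversions of w with those of
  \<open>w \<circ> sref i\<close> other than (i, Suc i), because the transposition reverses the
  order of no other pair.\<close>

lemma card_inversions_comp_sref:
  assumes w: "w permutes {1..n}" and i: "i \<in> {1..<n}" and less: "w i < w (Suc i)"
  shows "card (inversions n (w \<circ> sref i)) = Suc (card (inversions n w))"
proof -
  let ?h = "map_prod (sref i) (sref i)"
  have s: "sref i x \<in> {1..n} \<longleftrightarrow> x \<in> {1..n}" for x
    using permutes_in_image[OF sref_permutes[OF i]] .
  have "inversions n (w \<circ> sref i) = insert (i, Suc i) (?h ` inversions n w)"
  proof (intro equalityI subsetI)
    fix p assume p: "p \<in> inversions n (w \<circ> sref i)"
    obtain a b where ab: "p = (a, b)" by (cases p)
    show "p \<in> insert (i, Suc i) (?h ` inversions n w)"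
    proof (cases "a = i \<and> b = Suc i")
      case False
      have "(sref i a, sref i b) \<in> inversions n w"
        using p False sref_less_iff[of a i b] less s[of a] s[of b]
        unfolding inversions_def ab by auto
      then have "?h (sref i a, sref i b) \<in> ?h ` inversions n w" by (rule imageI)
      then show ?thesis by (simp add: ab)
    qed (simp add: ab)
  next
    fix p assume "p \<in> insert (i, Suc i) (?h ` inversions n w)"
    then consider "p = (i, Suc i)" | a b where "(a, b) \<in> inversions n w" "p = (sref i a, sref i b)"
      by auto
    then show "p \<in> inversions n (w \<circ> sref i)"
    proof cases
      case 1
      then show ?thesis using i less by (auto simp: inversions_def)
    next
      case 2
      then have "\<not> (a = i \<and> b = Suc i)" using less by (auto simp: inversions_def)
      then show ?thesis
        using 2 sref_less_iff[of a i b] s[of a] s[of b] unfolding inversions_def by auto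
    qed
  qed
  moreover have "(i, Suc i) \<notin> ?h ` inversions n w"
  proof
    assume "(i, Suc i) \<in> ?h ` inversions n w"
    then obtain a b where ab: "(a, b) \<in> inversions n w" "i = sref i a" "Suc i = sref i b"
      by auto
    then have "sref i i = a" "sref i (Suc i) = b"
      by (metis transpose_involutory)+
    with ab(1) show False by (simp add: inversions_def)
  qed
  moreover have "inj_on ?h (inversions n w)"
    by (rule inj_on_subset[OF prod.inj_map subset_UNIV]) (simp_all add: inj_sref)
  ultimately show ?thesis
    by (simp add: finite_inversions card_image)
qed

lemma ascent_cases:
  assumes "w permutes {1..n}"
  obtains "w i < w (Suc i)" | "w (Suc i) < w i"
  using assms by (metis linorder_neqE_nat n_not_Suc_n permutes_inverses(2))

lemma card_inversions_comp_sref_descent: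
  assumes w: "w permutes {1..n}" and i: "i \<in> {1..<n}" and less: "w (Suc i) < w i"
  shows "card (inversions n w) = Suc (card (inversions n (w \<circ> sref i)))"
  using card_inversions_comp_sref[OF permutes_compose[OF sref_permutes[OF i] w] i] less
  by (simp add: comp_assoc)

lemma card_inversions_comp_sref_le:
  assumes w: "w permutes {1..n}" and i: "i \<in> {1..<n}"
  shows "card (inversions n (w \<circ> sref i)) \<le> Suc (card (inversions n w))"
  using card_inversions_comp_sref[OF w i] card_inversions_comp_sref_descent[OF w i]
  by (cases rule: ascent_cases[OF w, of i]) simp_all

lemma permutes_no_descent:
  assumes w: "w permutes {1..n}" and asc: "\<And>i. i \<in> {1..<n} \<Longrightarrow> \<not> w (Suc i) < w i"
  shows "w = id"
proof -
  have asc': "w i < w (Suc i)" if "i \<in> {1..<n}" for i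
    using asc[OF that] ascent_cases[OF w, of i] by blast
  \<comment> \<open>Strictly increasing positive values satisfy this by induction, and a permutation
    of {1..n} that lowers no point is the identity.\<close>
  have "\<forall>j\<in>{1..n}. j \<le> w j"
  proof
    fix j assume "j \<in> {1..n}"
    then show "j \<le> w j"
    proof (induction j)
      case (Suc j)
      show ?case
      proof (cases "j = 0")
        case True
        then show ?thesis using permutes_in_image[OF w, of "Suc j"] Suc.prems by simp
      next
        case False
        then show ?thesis using Suc asc'[of j] by simp
      qed
    qed simp
  qed
  then show ?thesis using permutes_natset_ge[OF w] by simp
qed

text \<open>Removing a descent removes exactly one inversion, and the letter put back is then
  applied at an ascent. Hence one and the same word computes w in the group and in the 0-Hecke
  monoid.\<close>

lemma reduced_word:
  assumes "w permutes {1..n}"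
  shows "\<exists>a. set a \<subseteq> {1..<n} \<and> length a = card (inversions n w)
    \<and> foldl rmul id a = w \<and> foldl (\<lambda>u i. u \<circ> sref i) id a = w"
  using assms
proof (induction "card (inversions n w)" arbitrary: w rule: less_induct)
  case less
  show ?case
  proof (cases "\<exists>i\<in>{1..<n}. w (Suc i) < w i")
    case True
    then obtain i where i: "i \<in> {1..<n}" "w (Suc i) < w i" by blast
    have *: "card (inversions n w) = Suc (card (inversions n (w \<circ> sref i)))"
      using card_inversions_comp_sref_descent less.prems i by blast
    have "w \<circ> sref i permutes {1..n}"
      using less.prems i(1) by (simp add: permutes_compose sref_permutes)
    then obtain a where a: "set a \<subseteq> {1..<n}" "length a = card (inversions n (w \<circ> sref i))"
      "foldl rmul id a = w \<circ> sref i" "foldl (\<lambda>u i. u \<circ> sref i) id a = w \<circ> sref i"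
      using less.hyps[of "w \<circ> sref i"] * by auto
    have "rmul (w \<circ> sref i) i = w"
      using i by (simp add: rmul_def comp_assoc)
    then show ?thesis
      using a i * by (intro exI[of _ "a @ [i]"]) (simp add: comp_assoc)
  next
    case False
    then have "w = id" using permutes_no_descent less.prems by blast
    then show ?thesis
      by (intro exI[of _ "[]"]) simp
  qed
qed

lemma card_inversions_word_le:
  assumes "w permutes {1..n}" "set a \<subseteq> {1..<n}"
  shows "card (inversions n (foldl (\<lambda>u i. u \<circ> sref i) w a)) \<le> card (inversions n w) + length a"
  using assms
proof (induction a arbitrary: w)
  case (Cons i a)
  then have i: "i \<in> {1..<n}" and a: "set a \<subseteq> {1..<n}" by auto
  have "card (inversions n (foldl (\<lambda>u i. u \<circ> sref i) (w \<circ> sref i) a))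
      \<le> card (inversions n (w \<circ> sref i)) + length a"
    by (rule Cons.IH[OF permutes_compose[OF sref_permutes[OF i] Cons.prems(1)] a])
  with card_inversions_comp_sref_le[OF Cons.prems(1) i]
  show ?case unfolding foldl_Cons length_Cons by linarith
qed simp

lemma coxeter_length_eq:
  assumes w: "w permutes {1..n}"
  shows "coxeter_length n w = card (inversions n w)"
  unfolding coxeter_length_def
proof (rule Least_equality)
  show "\<exists>a. length a = card (inversions n w) \<and> set a \<subseteq> {1..<n} \<and> foldl (\<lambda>u i. u \<circ> sref i) id a = w"
    using reduced_word[OF w] by blast
  \<comment> \<open>The identity has no inversions and each letter creates at most one.\<close>
  show "card (inversions n w) \<le> p"
    if "\<exists>a. length a = p \<and> set a \<subseteq> {1..<n} \<and> foldl (\<lambda>u i. u \<circ> sref i) id a = w" for p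
    using that card_inversions_word_le[OF permutes_id] by fastforce
qed

lemma card_inversions_inv:
  assumes w: "w permutes {1..n}"
  shows "card (inversions n (inv w)) = card (inversions n w)"
proof (rule bij_betw_same_card[symmetric])
  have r: "w x \<in> {1..n} \<longleftrightarrow> x \<in> {1..n}" "inv w x \<in> {1..n} \<longleftrightarrow> x \<in> {1..n}" for x
    using permutes_in_image[OF w] permutes_in_image[OF permutes_inv[OF w]] by auto
  show "bij_betw (\<lambda>(a, b). (w b, w a)) (inversions n w) (inversions n (inv w))"
    by (rule bij_betw_byWitness[where f' = "\<lambda>(a, b). (inv w b, inv w a)"])
      (use r in \<open>auto simp: inversions_def permutes_inverses[OF w] simp del: atLeastAtMost_iff\<close>)
qed

section \<open>The 0-Hecke product in terms of ascents\<close>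

lemma hecke_right_eq:
  assumes "w permutes {1..n}" "i \<in> {1..<n}"
  shows "hecke_right n w i = rmul w i"
proof -
  have "w \<circ> sref i permutes {1..n}" using assms by (simp add: permutes_compose sref_permutes)
  then have "coxeter_length n w < coxeter_length n (w \<circ> sref i) \<longleftrightarrow> w i < w (Suc i)"
    using card_inversions_comp_sref[OF assms]
      card_inversions_comp_sref_descent[OF assms]
    by (cases rule: ascent_cases[OF assms(1), of i])
      (simp_all add: coxeter_length_eq[OF assms(1)] coxeter_length_eq)
  then show ?thesis by (simp add: hecke_right_def rmul_def)
qed

text \<open>Passing to inverses preserves the length and turns left multiplication into right
  multiplication.\<close>

lemma hecke_left_eq:
  assumes w: "w permutes {1..n}" and i: "i \<in> {1..<n}"
  shows "hecke_left n i w = lmul i w"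
proof -
  have w': "inv w permutes {1..n}" using permutes_inv[OF w] .
  have sw: "sref i \<circ> w permutes {1..n}" using assms by (simp add: permutes_compose sref_permutes)
  have "coxeter_length n (sref i \<circ> w) = card (inversions n (inv w \<circ> sref i))"
    using coxeter_length_eq[OF sw] card_inversions_inv[OF sw]
    by (simp add: inv_sref_comp permutes_bij[OF w])
  moreover have "coxeter_length n w = card (inversions n (inv w))"
    using coxeter_length_eq[OF w] card_inversions_inv[OF w] by simp
  ultimately have "coxeter_length n w < coxeter_length n (sref i \<circ> w) \<longleftrightarrow> inv w i < inv w (Suc i)"
    using card_inversions_comp_sref[OF w' i] card_inversions_comp_sref_descent[OF w' i]
    by (cases rule: ascent_cases[OF w', of i]) simp_all
  then show ?thesis by (simp add: hecke_left_def lmul_def)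
qed

lemma foldl_hecke_right:
  assumes "w permutes {1..n}" "set a \<subseteq> {1..<n}"
  shows "foldl (hecke_right n) w a = foldl rmul w a"
  using assms
proof (induction a arbitrary: w)
  case (Cons i a)
  then have i: "i \<in> {1..<n}" by simp
  with Cons hecke_right_eq[OF _ i, of w] rmul_permutes[OF _ i, of w] show ?case by simp
qed simp

lemma hecke_word_eq: "set a \<subseteq> {1..<n} \<Longrightarrow> hecke_word n a = foldl rmul id a"
  by (simp add: hecke_word_def foldl_hecke_right permutes_id)

lemma card_inversions_foldl_rmul:
  assumes "w permutes {1..n}" "set a \<subseteq> {1..<n}"
  shows "card (inversions n (foldl rmul w a)) \<le> card (inversions n w) + length a"
  using assms
proof (induction a arbitrary: w)
  case (Cons i a)
  then have i: "i \<in> {1..<n}" by simp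
  have "card (inversions n (rmul w i)) \<le> Suc (card (inversions n w))"
    using card_inversions_comp_sref_le[OF Cons.prems(1) i] by (simp add: rmul_def)
  with Cons.IH[of "rmul w i"] Cons.prems rmul_permutes[OF _ i, of w] show ?case by simp
qed simp

lemma foldl_lmul_inv: "bij w \<Longrightarrow> foldl (\<lambda>u i. lmul i u) (inv w) a = inv (foldl rmul w a)"
  by (induction a arbitrary: w) (simp_all add: inv_rmul[symmetric] bij_rmul)

text \<open>The permutation w is reached from the identity by left multiplications. These commute
  with the right multiplications by e and e', so equality at the identity propagates to w.\<close>

lemma foldl_rmul_cong:
  assumes w: "w permutes {1..n}" and e: "foldl rmul id e = foldl rmul id e'"
  shows "foldl rmul w e = foldl rmul w e'"
proof -
  obtain a where a: "set a \<subseteq> {1..<n}" "foldl rmul id a = inv w"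
    using reduced_word[OF permutes_inv[OF w]] by blast
  \<comment> \<open>Inversion turns a right word for \<open>inv w\<close> into a left word for
    w.\<close>
  have "w = foldl (\<lambda>u i. lmul i u) id a"
    using foldl_lmul_inv[OF bij_id, of a] a(2) permutes_inv_inv[OF w] by simp
  moreover have "foldl rmul (foldl (\<lambda>u i. lmul i u) v a) e = foldl rmul (foldl (\<lambda>u i. lmul i u) v a) e'"
    if "bij v" "foldl rmul v e = foldl rmul v e'" for v
    using that
    by (induction a arbitrary: v) (simp_all add: bij_lmul flip: lmul_foldl_rmul)
  ultimately show ?thesis using e by simp
qed


section \<open>Sorting block colours\<close>

text \<open>When c gives the block colour of each value, this sends a value to the position it would
  occupy if the entries of every block were sorted increasingly. Outside {1..n} it is the identity,
  so that it can be a permutation of {1..n}.\<close>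

definition rank :: "nat \<Rightarrow> (nat \<Rightarrow> nat) \<Rightarrow> nat \<Rightarrow> nat" where
  "rank n c i =
     (if i \<in> {1..n} then card {w \<in> {1..n}. c w < c i \<or> c w = c i \<and> w \<le> i} else i)"

lemma rank_less:
  assumes "i \<in> {1..n}" "j \<in> {1..n}" "c i < c j \<or> c i = c j \<and> i < j"
  shows "rank n c i < rank n c j"
proof -
  have "{w \<in> {1..n}. c w < c i \<or> c w = c i \<and> w \<le> i} \<subset> {w \<in> {1..n}. c w < c j \<or> c w = c j \<and> w \<le> j}"
    using assms by (intro psubsetI) auto
  from psubset_card_mono[OF _ this] show ?thesis using assms by (simp add: rank_def)
qed

lemma rank_less_iff:
  assumes "i \<in> {1..n}" "j \<in> {1..n}"
  shows "rank n c i < rank n c j \<longleftrightarrow> c i < c j \<or> c i = c j \<and> i < j"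
  using rank_less[OF assms, of c] rank_less[OF assms(2,1), of c]
  by (cases "c i" "c j" rule: linorder_cases; cases i j rule: linorder_cases) simp_all

lemma rank_in: "i \<in> {1..n} \<Longrightarrow> rank n c i \<in> {1..n}"
proof -
  assume i: "i \<in> {1..n}"
  let ?A = "{w \<in> {1..n}. c w < c i \<or> c w = c i \<and> w \<le> i}"
  have "card ?A \<le> card {1..n}" by (rule card_mono) auto
  moreover have "card ?A > 0" using i by (intro card_gt_0_iff[THEN iffD2]) auto
  ultimately show ?thesis using i by (simp add: rank_def)
qed

lemma rank_permutes: "rank n c permutes {1..n}"
proof (rule bij_imp_permutes)
  have "inj_on (rank n c) {1..n}"
  proof (rule inj_onI)
    fix x y assume "x \<in> {1..n}" "y \<in> {1..n}" "rank n c x = rank n c y"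
    then show "x = y" using rank_less_iff[of x n y c] rank_less_iff[of y n x c] by auto
  qed
  moreover have "rank n c ` {1..n} \<subseteq> {1..n}" using rank_in by blast
  ultimately show "bij_betw (rank n c) {1..n} {1..n}"
    by (simp add: bij_betw_def endo_inj_surj)
qed (auto simp: rank_def)

lemma rank_Suc:
  assumes "i \<in> {1..<n}" "c i = c (Suc i)"
  shows "rank n c (Suc i) = Suc (rank n c i)"
proof -
  have "{w \<in> {1..n}. c w < c (Suc i) \<or> c w = c (Suc i) \<and> w \<le> Suc i}
      = insert (Suc i) {w \<in> {1..n}. c w < c i \<or> c w = c i \<and> w \<le> i}"
    using assms by (auto simp: le_Suc_eq)
  then show ?thesis using assms by (simp add: rank_def)
qed

text \<open>Values are compared directly only when their colours tie, and \<open>sref i\<close>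
  reverses the order of no pair except i, Suc i, which are not tied.\<close>

lemma rank_comp_sref:
  assumes i: "i \<in> {1..<n}" and ne: "c i \<noteq> c (Suc i)"
  shows "rank n (c \<circ> sref i) = rank n c \<circ> sref i"
proof
  fix x
  note s = sref_permutes[OF i]
  show "rank n (c \<circ> sref i) x = (rank n c \<circ> sref i) x"
  proof (cases "x \<in> {1..n}")
    case True
    let ?A = "\<lambda>c x. {w \<in> {1..n}. c w < c x \<or> c w = c x \<and> w \<le> (x::nat)}"
    have le: "w \<le> x \<longleftrightarrow> sref i w \<le> sref i x" if "c (sref i w) = c (sref i x)" for w
    proof -
      have "\<not> (x = i \<and> w = Suc i)" "\<not> (x = Suc i \<and> w = i)" using ne that by auto
      from sref_less_iff[OF this] show ?thesis by (simp add: not_less[symmetric])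
    qed
    have "w \<in> ?A (c \<circ> sref i) x \<longleftrightarrow> sref i w \<in> ?A c (sref i x)" for w
      using permutes_in_image[OF s, of w] le[of w] by auto
    then have "?A (c \<circ> sref i) x = sref i -` ?A c (sref i x)" by blast
    also have "\<dots> = sref i ` ?A c (sref i x)"
      unfolding bij_vimage_eq_inv_image[OF bij_sref] by simp
    finally have "?A (c \<circ> sref i) x = sref i ` ?A c (sref i x)" .
    then have "card (?A (c \<circ> sref i) x) = card (?A c (sref i x))"
      by (simp add: card_image inj_on_subset[OF inj_sref])
    then show ?thesis
      using True permutes_in_image[OF s, of x] by (simp add: rank_def)
  next
    case False
    then show ?thesis
      by (simp add: rank_def permutes_not_in[OF s False] del: atLeastAtMost_iff)
  qed
qed

lemma rank_mono_eq_id: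
  assumes "mono \<beta>"
  shows "rank n \<beta> = id"
proof
  fix i
  have "\<beta> w < \<beta> i \<or> \<beta> w = \<beta> i \<and> w \<le> i \<longleftrightarrow> w \<le> i" for w
    using monoD[OF assms, of w i] monoD[OF assms, of i w] by (cases "w \<le> i") auto
  moreover have "i \<le> n \<Longrightarrow> {w \<in> {1..n}. w \<le> i} = {1..i}" by auto
  ultimately show "rank n \<beta> i = id i" by (simp add: rank_def)
qed

text \<open>Positions and values are matched by \<pi>, so the number of values of a given colour
  does not depend on \<pi>.\<close>

lemma card_color:
  fixes \<pi> :: "nat \<Rightarrow> nat"
  assumes "\<pi> permutes {1..n}"
  shows "card {w \<in> {1..n}. P ((\<beta> \<circ> inv \<pi>) w)} = card {p \<in> {1..n}. P (\<beta> p)}"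
proof -
  have "{w \<in> {1..n}. P ((\<beta> \<circ> inv \<pi>) w)} = \<pi> ` {p \<in> {1..n}. P (\<beta> p)}"
  proof (intro equalityI subsetI)
    fix w assume "w \<in> {w \<in> {1..n}. P ((\<beta> \<circ> inv \<pi>) w)}"
    then have "inv \<pi> w \<in> {p \<in> {1..n}. P (\<beta> p)}"
      using permutes_in_image[OF permutes_inv[OF assms], of w] by simp
    then show "w \<in> \<pi> ` {p \<in> {1..n}. P (\<beta> p)}"
      using permutes_inverses(1)[OF assms, of w] by (metis image_eqI)
  qed (use permutes_in_image[OF assms] permutes_inverses(2)[OF assms] in auto)
  then show ?thesis
    by (simp add: card_image inj_on_subset[OF permutes_inj[OF assms]])
qed

text \<open>Sorting values by colour reproduces the blocks, since each colour has as many values as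
  positions and \<beta> is monotone. A rank lying in too late or too early a block contradicts the
  number of values whose colour is at most, respectively below, \<open>c i\<close>.\<close>

lemma color_rank:
  fixes \<beta> \<pi> :: "nat \<Rightarrow> nat"
  assumes \<pi>: "\<pi> permutes {1..n}" and \<beta>: "mono \<beta>" and i: "i \<in> {1..n}"
  defines "c \<equiv> \<beta> \<circ> inv \<pi>"
  shows "\<beta> (rank n c i) = c i"
proof -
  let ?S = "{w \<in> {1..n}. c w < c i \<or> c w = c i \<and> w \<le> i}"
  define s where "s = rank n c i"
  have S: "card ?S = s" using i by (simp add: rank_def s_def)
  have s: "s \<in> {1..n}" unfolding s_def by (rule rank_in[OF i])
  have "\<beta> s = c i"
  proof (rule ccontr)
    assume "\<beta> s \<noteq> c i"
    then consider "c i < \<beta> s" | "\<beta> s < c i" by linarith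
    then show False
    proof cases
      case 1
      have "s \<le> card {w \<in> {1..n}. c w \<le> c i}" unfolding S[symmetric] by (rule card_mono) auto
      also have "\<dots> = card {p \<in> {1..n}. \<beta> p \<le> c i}" unfolding c_def by (rule card_color[OF \<pi>])
      also have "\<dots> \<le> card {1..<s}"
      proof (rule card_mono)
        have "p < s" if "\<beta> p \<le> c i" for p
          using monoD[OF \<beta>, of s p] that 1 by (cases "p < s") auto
        then show "{p \<in> {1..n}. \<beta> p \<le> c i} \<subseteq> {1..<s}" by auto
      qed simp
      also have "\<dots> < s" using s by simp
      finally show False by simp
    next
      case 2
      have "s = card {1..s}" by simp
      also have "\<dots> \<le> card {p \<in> {1..n}. \<beta> p < c i}"
      proof (rule card_mono)
        have "\<beta> p < c i" if "p \<le> s" for p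
          using monoD[OF \<beta> that] 2 by simp
        then show "{1..s} \<subseteq> {p \<in> {1..n}. \<beta> p < c i}" using s by auto
      qed simp
      also have "\<dots> = card {w \<in> {1..n}. c w < c i}"
        unfolding c_def by (rule card_color[OF \<pi>, symmetric])
      also have "\<dots> < s" unfolding S[symmetric] using i by (intro psubset_card_mono) auto
      finally show False by simp
    qed
  qed
  then show ?thesis by (simp add: s_def)
qed


section \<open>The action in terms of block colours\<close>

text \<open>The rank is taken in the colouring before the values are sorted. Swapping two values of
  equal colour leaves that colouring unchanged, so taking it afterwards would give the same
  position.\<close>

definition block_act :: "nat \<Rightarrow> (nat \<Rightarrow> nat) \<Rightarrow> (nat \<Rightarrow> nat) \<Rightarrow> nat \<Rightarrow> (nat \<Rightarrow> nat)" where
  "block_act n \<beta> \<pi> i =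
     (let c = \<beta> \<circ> inv \<pi>
      in if c i = c (Suc i) then rmul (lmul i \<pi>) (rank n c i) else lmul i \<pi>)"

lemma rank_in_less:
  assumes "i \<in> {1..<n}" "c i = c (Suc i)"
  shows "rank n c i \<in> {1..<n}"
  using rank_in[of i n c] rank_in[of "Suc i" n c] rank_Suc[of i n c] assms by simp

lemma block_act_permutes:
  assumes "\<pi> permutes {1..n}" "i \<in> {1..<n}"
  shows "block_act n \<beta> \<pi> i permutes {1..n}"
  using rmul_permutes[OF lmul_permutes[OF assms], of "rank n (\<beta> \<circ> inv \<pi>) i"]
    lmul_permutes[OF assms] rank_in_less[OF assms(2), of "\<beta> \<circ> inv \<pi>"]
  by (simp add: block_act_def Let_def)

section \<open>Change of colours under the action, and passage from a fine colouring to a coarse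
  one\<close>

lemma color_rmul:
  assumes "bij w" "\<beta> j = \<beta> (Suc j)"
  shows "\<beta> \<circ> inv (rmul w j) = \<beta> \<circ> inv w"
proof -
  have "\<beta> \<circ> sref j = \<beta>" using assms(2) by (auto simp: fun_eq_iff transpose_def)
  then show ?thesis by (simp add: rmul_def inv_comp_sref[OF assms(1)] comp_assoc[symmetric])
qed

lemma color_lmul_eq:
  assumes "bij w" "(\<beta> \<circ> inv w) i = (\<beta> \<circ> inv w) (Suc i)"
  shows "\<beta> \<circ> inv (lmul i w) = \<beta> \<circ> inv w"
proof -
  have "\<beta> \<circ> inv w \<circ> sref i = \<beta> \<circ> inv w" using assms(2) by (auto simp: fun_eq_iff transpose_def)
  then show ?thesis by (simp add: lmul_def inv_sref_comp[OF assms(1)] comp_assoc[symmetric])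
qed

text \<open>For distinct colours, monotonicity of \<beta> makes the order of the two positions the
  order of their colours, so the test of \<open>lmul\<close> can be read off the colours
  alone.\<close>

lemma lmul_color_neq:
  assumes \<beta>: "mono \<beta>" and w: "bij w" and ne: "(\<beta> \<circ> inv w) i \<noteq> (\<beta> \<circ> inv w) (Suc i)"
  shows "lmul i w = (if (\<beta> \<circ> inv w) i < (\<beta> \<circ> inv w) (Suc i) then sref i \<circ> w else w)"
    and "\<beta> \<circ> inv (lmul i w) = (if (\<beta> \<circ> inv w) i < (\<beta> \<circ> inv w) (Suc i)
      then \<beta> \<circ> inv w \<circ> sref i else \<beta> \<circ> inv w)"
proof -
  have "inv w i < inv w (Suc i) \<longleftrightarrow> (\<beta> \<circ> inv w) i < (\<beta> \<circ> inv w) (Suc i)"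
    using monoD[OF \<beta>, of "inv w i" "inv w (Suc i)"] monoD[OF \<beta>, of "inv w (Suc i)" "inv w i"] ne
    by (cases "inv w i < inv w (Suc i)") auto
  then show "lmul i w = (if (\<beta> \<circ> inv w) i < (\<beta> \<circ> inv w) (Suc i) then sref i \<circ> w else w)"
    by (simp add: lmul_def)
  then show "\<beta> \<circ> inv (lmul i w) = (if (\<beta> \<circ> inv w) i < (\<beta> \<circ> inv w) (Suc i)
      then \<beta> \<circ> inv w \<circ> sref i else \<beta> \<circ> inv w)"
    by (simp add: inv_sref_comp[OF w] comp_assoc)
qed

lemma color_block_act:
  assumes \<pi>: "\<pi> permutes {1..n}" and \<beta>: "mono \<beta>" and i: "i \<in> {1..<n}"
    and eq: "(\<beta> \<circ> inv \<pi>) i = (\<beta> \<circ> inv \<pi>) (Suc i)"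
  shows "\<beta> \<circ> inv (block_act n \<beta> \<pi> i) = \<beta> \<circ> inv \<pi>"
proof -
  let ?c = "\<beta> \<circ> inv \<pi>"
  have "\<beta> (rank n ?c i) = \<beta> (Suc (rank n ?c i))"
    using color_rank[OF \<pi> \<beta>, of i] color_rank[OF \<pi> \<beta>, of "Suc i"] eq
      rank_Suc[of i n ?c] i by simp
  then show ?thesis
    using eq color_rmul[OF bij_lmul[OF permutes_bij[OF \<pi>]], of \<beta> "rank n ?c i" i]
      color_lmul_eq[OF permutes_bij[OF \<pi>] eq]
    by (simp add: block_act_def Let_def)
qed

text \<open>This is one step of an invariant: \<pi> is \<tau> multiplied on the right by e, both
  have the same \<gamma>-colours, and the 0-Hecke product of e is computed from the colours of
  \<tau>. The word e may change; what matters is its product.\<close>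

lemma block_act_simulation:
  fixes \<beta> \<gamma> :: "nat \<Rightarrow> nat"
  assumes \<beta>: "mono \<beta>" and \<gamma>: "mono \<gamma>" and coarse: "\<And>x y. \<beta> x = \<beta> y \<Longrightarrow> \<gamma> x = \<gamma> y"
    and i: "i \<in> {1..<n}" and \<tau>: "\<tau> permutes {1..n}" and e: "set e \<subseteq> {1..<n}"
    and \<pi>: "\<pi> = foldl rmul \<tau> e" and c: "\<gamma> \<circ> inv \<pi> = \<gamma> \<circ> inv \<tau>"
    and q: "foldl rmul id e = rank n (\<beta> \<circ> inv \<tau>) \<circ> inv (rank n (\<gamma> \<circ> inv \<tau>))"
  obtains e' where "set e' \<subseteq> {1..<n}" "block_act n \<gamma> \<pi> i = foldl rmul (block_act n \<beta> \<tau> i) e'"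
    "\<gamma> \<circ> inv (block_act n \<gamma> \<pi> i) = \<gamma> \<circ> inv (block_act n \<beta> \<tau> i)"
    "foldl rmul id e' = rank n (\<beta> \<circ> inv (block_act n \<beta> \<tau> i))
       \<circ> inv (rank n (\<gamma> \<circ> inv (block_act n \<beta> \<tau> i)))"
proof -
  define b where "b = \<beta> \<circ> inv \<tau>"
  define g where "g = \<gamma> \<circ> inv \<tau>"
  define \<tau>' where "\<tau>' = block_act n \<beta> \<tau> i"
  define \<pi>' where "\<pi>' = block_act n \<gamma> \<pi> i"
  have \<pi>n: "\<pi> permutes {1..n}" unfolding \<pi> by (rule foldl_rmul_permutes[OF \<tau> e])
  have bij: "bij \<tau>" "bij \<pi>" "bij (rank n g)" "bij (rank n b)"
    using \<tau> \<pi>n rank_permutes permutes_bij by blast+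
  have lm: "lmul i \<pi> = foldl rmul (lmul i \<tau>) e"
    unfolding \<pi> by (rule lmul_foldl_rmul[OF bij(1)])
  let ?q = "rank n b \<circ> inv (rank n g)"
  have q: "foldl rmul id e = ?q" using q by (simp add: b_def g_def)
  have cg: "\<gamma> \<circ> inv \<pi> = g" using c by (simp add: g_def)
  have invg: "inv (rank n g) (rank n g x) = x" for x
    using bij(3) by (simp add: bij_is_inj)
  have bg: "b x = b y \<Longrightarrow> g x = g y" for x y
    using coarse[of "inv \<tau> x" "inv \<tau> y"] by (simp add: b_def g_def)
  \<comment> \<open>Equal fine colours force equal coarse colours, which leaves three cases.\<close>
  consider (fine) "b i = b (Suc i)" "g i = g (Suc i)"
    | (mid) "b i \<noteq> b (Suc i)" "g i = g (Suc i)"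
    | (far) "b i \<noteq> b (Suc i)" "g i \<noteq> g (Suc i)" using bg by blast
  then have "\<exists>e'. set e' \<subseteq> {1..<n} \<and> \<pi>' = foldl rmul \<tau>' e' \<and> \<gamma> \<circ> inv \<pi>' = \<gamma> \<circ> inv \<tau>' \<and>
    foldl rmul id e' = rank n (\<beta> \<circ> inv \<tau>') \<circ> inv (rank n (\<gamma> \<circ> inv \<tau>'))"
  proof cases
    \<comment> \<open>Both actions sort positions, the fine one at j and the coarse one at k. Since
      q carries k, Suc k to j, Suc j, a letter k after e has the same effect as a letter j before e,
      and the fine action already supplies the latter. So e is kept.\<close>
    case fine
    let ?j = "rank n b i" and ?k = "rank n g i"
    have \<tau>': "\<tau>' = rmul (lmul i \<tau>) ?j" using fine by (simp add: \<tau>'_def block_act_def b_def)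
    have \<pi>': "\<pi>' = rmul (lmul i \<pi>) ?k" using fine by (simp add: \<pi>'_def block_act_def cg)
    have cb: "\<beta> \<circ> inv \<tau>' = b"
      unfolding \<tau>'_def b_def by (rule color_block_act[OF \<tau> \<beta> i]) (use fine in \<open>simp add: b_def\<close>)
    have cg': "\<gamma> \<circ> inv \<pi>' = g"
      unfolding \<pi>'_def cg[symmetric]
      by (rule color_block_act[OF \<pi>n \<gamma> i]) (use fine in \<open>simp only: cg\<close>)
    have cg'': "\<gamma> \<circ> inv \<tau>' = g"
    proof
      fix x
      show "(\<gamma> \<circ> inv \<tau>') x = g x"
        using coarse[of "inv \<tau>' x" "inv \<tau> x"] fun_cong[OF cb, of x] by (simp add: b_def g_def)
    qed
    have Suc: "rank n b (Suc i) = Suc ?j" "rank n g (Suc i) = Suc ?k"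
      using rank_Suc[OF i] fine by simp_all
    have qk: "?q ?k = ?j" "?q (Suc ?k) = Suc ?j"
      using Suc invg[of i] invg[of "Suc i"] by simp_all
    have bq: "bij ?q" using bij by (intro bij_comp) (simp_all add: bij_imp_bij_inv)
    have iq: "inv ?q ?j = ?k" "inv ?q (Suc ?j) = Suc ?k"
      using qk bij_is_inj[OF bq] by (metis inv_f_f)+
    have "foldl rmul id (e @ [?k]) = rmul ?q ?k" by (simp add: q)
    also have "\<dots> = ?q \<circ> sref ?k" unfolding rmul_def qk by simp
    also have "\<dots> = sref ?j \<circ> ?q" by (rule comp_sref_eq_sref_comp[OF bq qk])
    also have "\<dots> = lmul ?j ?q" unfolding lmul_def iq by simp
    also have "\<dots> = foldl rmul (lmul ?j id) e" unfolding q[symmetric]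
      by (rule lmul_foldl_rmul) simp
    \<comment> \<open>At the identity, left and right multiplication by a single letter
      coincide.\<close>
    also have "\<dots> = foldl rmul id (?j # e)" by (simp add: lmul_def rmul_def)
    finally have "foldl rmul (lmul i \<tau>) (e @ [?k]) = foldl rmul (lmul i \<tau>) (?j # e)"
      by (rule foldl_rmul_cong[OF lmul_permutes[OF \<tau> i]])
    then have "\<pi>' = foldl rmul \<tau>' e" by (simp add: \<pi>' \<tau>' lm)
    then show ?thesis using e cb cg' cg'' q by (intro exI[of _ e]) simp
  next
    \<comment> \<open>Only the coarse action sorts positions, so e is extended by k. On q this
      letter acts exactly when \<open>b i < b (Suc i)\<close>, which is exactly when the fine
      colours of i and Suc i are exchanged.\<close>
    case mid
    let ?k = "rank n g i"
    have \<tau>': "\<tau>' = lmul i \<tau>" using mid by (simp add: \<tau>'_def block_act_def b_def)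
    have \<pi>': "\<pi>' = rmul (lmul i \<pi>) ?k" using mid by (simp add: \<pi>'_def block_act_def cg)
    have cg': "\<gamma> \<circ> inv \<pi>' = g"
      unfolding \<pi>'_def cg[symmetric]
      by (rule color_block_act[OF \<pi>n \<gamma> i]) (use mid in \<open>simp only: cg\<close>)
    have cg'': "\<gamma> \<circ> inv \<tau>' = g"
      unfolding \<tau>' g_def by (rule color_lmul_eq[OF bij(1)]) (use mid in \<open>simp add: g_def\<close>)
    have cb: "\<beta> \<circ> inv \<tau>' = (if b i < b (Suc i) then b \<circ> sref i else b)"
      using lmul_color_neq(2)[OF \<beta> bij(1), of i] mid unfolding \<tau>' b_def by simp
    have Suc: "rank n g (Suc i) = Suc ?k"
      using rank_Suc[OF i] mid by simp
    have qk: "?q ?k = rank n b i" "?q (Suc ?k) = rank n b (Suc i)"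
      using Suc invg[of i] invg[of "Suc i"] by simp_all
    have lt: "rank n b i < rank n b (Suc i) \<longleftrightarrow> b i < b (Suc i)"
      using rank_less_iff[of i n "Suc i" b] i mid by auto
    have "?q \<circ> sref ?k = rank n b \<circ> sref i \<circ> inv (rank n g)"
    proof -
      have "inv (rank n g) \<circ> sref ?k = sref i \<circ> inv (rank n g)"
        by (rule comp_sref_eq_sref_comp)
          (use bij(3) Suc invg[of i] invg[of "Suc i"] in \<open>simp_all add: bij_imp_bij_inv\<close>)
      then show ?thesis by (simp add: comp_assoc)
    qed
    then have "rmul ?q ?k = rank n (\<beta> \<circ> inv \<tau>') \<circ> inv (rank n g)"
      unfolding rmul_def qk lt cb using rank_comp_sref[OF i mid(1)] by simp
    then show ?thesis using e cg' cg'' q rank_in_less[of i n g] i mid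
      by (intro exI[of _ "e @ [?k]"]) (simp add: \<tau>' \<pi>' lm)
  next
    \<comment> \<open>Neither action sorts positions. Both colourings compare i and Suc i as their
      positions in \<tau> do, so both or neither are exchanged, and the two copies of
      \<open>sref i\<close> cancel in the quotient of the ranks.\<close>
    case far
    have \<tau>': "\<tau>' = lmul i \<tau>" using far by (simp add: \<tau>'_def block_act_def b_def)
    have \<pi>': "\<pi>' = lmul i \<pi>" using far by (simp add: \<pi>'_def block_act_def cg)
    have cg': "\<gamma> \<circ> inv \<pi>' = (if g i < g (Suc i) then g \<circ> sref i else g)"
      using lmul_color_neq(2)[OF \<gamma> bij(2), of i] far unfolding \<pi>' cg by simp
    have cg'': "\<gamma> \<circ> inv \<tau>' = (if g i < g (Suc i) then g \<circ> sref i else g)"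
      using lmul_color_neq(2)[OF \<gamma> bij(1), of i] far unfolding \<tau>' g_def by simp
    have "b i < b (Suc i) \<longleftrightarrow> inv \<tau> i < inv \<tau> (Suc i)"
      using monoD[OF \<beta>, of "inv \<tau> i" "inv \<tau> (Suc i)"] monoD[OF \<beta>, of "inv \<tau> (Suc i)" "inv \<tau> i"] far
      by (cases "inv \<tau> i < inv \<tau> (Suc i)") (auto simp: b_def)
    moreover have "g i < g (Suc i) \<longleftrightarrow> inv \<tau> i < inv \<tau> (Suc i)"
      using monoD[OF \<gamma>, of "inv \<tau> i" "inv \<tau> (Suc i)"] monoD[OF \<gamma>, of "inv \<tau> (Suc i)" "inv \<tau> i"] far
      by (cases "inv \<tau> i < inv \<tau> (Suc i)") (auto simp: g_def)
    ultimately have bg_less: "b i < b (Suc i) \<longleftrightarrow> g i < g (Suc i)" by simp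
    have cb: "\<beta> \<circ> inv \<tau>' = (if g i < g (Suc i) then b \<circ> sref i else b)"
      using lmul_color_neq(2)[OF \<beta> bij(1), of i] far bg_less unfolding \<tau>' b_def by simp
    have "rank n (\<beta> \<circ> inv \<tau>') \<circ> inv (rank n (\<gamma> \<circ> inv \<tau>')) = ?q"
      unfolding cb cg''
      using rank_comp_sref[OF i far(1)] rank_comp_sref[OF i far(2)]
      by (simp add: inv_comp_sref[OF bij(3)] comp_assoc)
    then show ?thesis using e cg' cg'' q by (intro exI[of _ e]) (simp add: \<tau>' \<pi>' lm)
  qed
  then show ?thesis using that unfolding \<tau>'_def \<pi>'_def by blast
qed

lemma foldl_block_act_permutes:
  assumes "\<pi> permutes {1..n}" "set a \<subseteq> {1..<n}"
  shows "foldl (block_act n \<beta>) \<pi> a permutes {1..n}"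
  using assms
proof (induction a arbitrary: \<pi>)
  case (Cons i a)
  then show ?case using block_act_permutes[of \<pi> n i \<beta>] by simp
qed simp

lemma foldl_block_act_simulation:
  fixes \<beta> \<gamma> :: "nat \<Rightarrow> nat"
  assumes \<beta>: "mono \<beta>" and \<gamma>: "mono \<gamma>" and coarse: "\<And>x y. \<beta> x = \<beta> y \<Longrightarrow> \<gamma> x = \<gamma> y"
    and a: "set a \<subseteq> {1..<n}"
  defines "\<tau> \<equiv> foldl (block_act n \<beta>) id a" and "\<pi> \<equiv> foldl (block_act n \<gamma>) id a"
  obtains e where "\<pi> = foldl rmul \<tau> e"
    "foldl rmul id e = rank n (\<beta> \<circ> inv \<tau>) \<circ> inv (rank n (\<gamma> \<circ> inv \<tau>))"
proof -
  define inv_rel where "inv_rel \<tau> \<pi> \<longleftrightarrow> \<tau> permutes {1..n} \<and> (\<exists>e. set e \<subseteq> {1..<n}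
    \<and> \<pi> = foldl rmul \<tau> e \<and> \<gamma> \<circ> inv \<pi> = \<gamma> \<circ> inv \<tau>
    \<and> foldl rmul id e = rank n (\<beta> \<circ> inv \<tau>) \<circ> inv (rank n (\<gamma> \<circ> inv \<tau>)))" for \<tau> \<pi>
  \<comment> \<open>At the start the colours are weakly increasing, both ranks are the identity, and
    the empty word serves as e.\<close>
  have "inv_rel id id"
    unfolding inv_rel_def using rank_mono_eq_id[OF \<beta>] rank_mono_eq_id[OF \<gamma>]
    by (auto simp: permutes_id intro!: exI[of _ "[]"])
  moreover have "inv_rel (block_act n \<beta> \<tau> i) (block_act n \<gamma> \<pi> i)"
    if rel: "inv_rel \<tau> \<pi>" and i: "i \<in> {1..<n}" for \<tau> \<pi> i
  proof -
    from rel obtain e where \<tau>: "\<tau> permutes {1..n}" and e: "set e \<subseteq> {1..<n}"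
      "\<pi> = foldl rmul \<tau> e" "\<gamma> \<circ> inv \<pi> = \<gamma> \<circ> inv \<tau>"
      "foldl rmul id e = rank n (\<beta> \<circ> inv \<tau>) \<circ> inv (rank n (\<gamma> \<circ> inv \<tau>))"
      unfolding inv_rel_def by blast
    obtain e' where "set e' \<subseteq> {1..<n}"
      "block_act n \<gamma> \<pi> i = foldl rmul (block_act n \<beta> \<tau> i) e'"
      "\<gamma> \<circ> inv (block_act n \<gamma> \<pi> i) = \<gamma> \<circ> inv (block_act n \<beta> \<tau> i)"
      "foldl rmul id e' = rank n (\<beta> \<circ> inv (block_act n \<beta> \<tau> i))
         \<circ> inv (rank n (\<gamma> \<circ> inv (block_act n \<beta> \<tau> i)))"
      by (rule block_act_simulation[OF \<beta> \<gamma> coarse i \<tau> e])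
    then show ?thesis
      unfolding inv_rel_def using block_act_permutes[OF \<tau> i, of \<beta>]
      by (intro conjI exI[of _ e'])
  qed
  then have "inv_rel \<tau> \<pi> \<Longrightarrow> inv_rel (foldl (block_act n \<beta>) \<tau> a) (foldl (block_act n \<gamma>) \<pi> a)" for \<tau> \<pi>
    using a by (induction a arbitrary: \<tau> \<pi>) simp_all
  ultimately have "inv_rel \<tau> \<pi>" unfolding \<tau>_def \<pi>_def by blast
  then show ?thesis using that unfolding inv_rel_def by blast
qed

text \<open>The factor leading from the fine result to the coarse one has a product determined by
  the fine result. By \<open>foldl_rmul_cong\<close> the two factors obtained from a and a'
  therefore act alike on it.\<close>

lemma foldl_block_act_coarsen:
  fixes \<beta> \<gamma> :: "nat \<Rightarrow> nat"
  assumes \<beta>: "mono \<beta>" and \<gamma>: "mono \<gamma>" and coarse: "\<And>x y. \<beta> x = \<beta> y \<Longrightarrow> \<gamma> x = \<gamma> y"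
    and a: "set a \<subseteq> {1..<n}" and a': "set a' \<subseteq> {1..<n}"
    and eq: "foldl (block_act n \<beta>) id a = foldl (block_act n \<beta>) id a'"
  shows "foldl (block_act n \<gamma>) id a = foldl (block_act n \<gamma>) id a'"
proof -
  obtain e where e: "foldl (block_act n \<gamma>) id a = foldl rmul (foldl (block_act n \<beta>) id a) e"
    "foldl rmul id e = rank n (\<beta> \<circ> inv (foldl (block_act n \<beta>) id a))
       \<circ> inv (rank n (\<gamma> \<circ> inv (foldl (block_act n \<beta>) id a)))"
    using foldl_block_act_simulation[OF \<beta> \<gamma> coarse a] by blast
  obtain e' where e': "foldl (block_act n \<gamma>) id a' = foldl rmul (foldl (block_act n \<beta>) id a') e'"
    "foldl rmul id e' = rank n (\<beta> \<circ> inv (foldl (block_act n \<beta>) id a'))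
       \<circ> inv (rank n (\<gamma> \<circ> inv (foldl (block_act n \<beta>) id a')))"
    using foldl_block_act_simulation[OF \<beta> \<gamma> coarse a'] by blast
  have "foldl (block_act n \<beta>) id a permutes {1..n}"
    by (rule foldl_block_act_permutes[OF permutes_id a])
  then show ?thesis using foldl_rmul_cong[of _ n e e'] e e' eq by simp
qed

section \<open>Independence of the action from the chosen 0-Hecke word\<close>

lemma foldl_block_act_inj:
  assumes \<beta>: "inj \<beta>" and "\<pi> permutes {1..n}" "set a \<subseteq> {1..<n}"
  shows "foldl (block_act n \<beta>) \<pi> a = foldl (\<lambda>u i. lmul i u) \<pi> a"
  using assms(2-)
proof (induction a arbitrary: \<pi>)
  case (Cons i a)
  then have i: "i \<in> {1..<n}" by simp
  have "\<beta> (inv \<pi> i) \<noteq> \<beta> (inv \<pi> (Suc i))"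
    using permutes_inj[OF permutes_inv[OF Cons.prems(1)]] \<beta> by (simp add: inj_eq)
  then have "block_act n \<beta> \<pi> i = lmul i \<pi>" by (simp add: block_act_def)
  then show ?case using Cons lmul_permutes[OF Cons.prems(1) i] by simp
qed simp

text \<open>For the finest colouring \<open>id\<close> no two values share a colour, and the state
  is the inverse of the 0-Hecke product of the word. Coarsening from \<open>id\<close> to \<gamma>
  gives the claim.\<close>

lemma foldl_block_act_hecke_word:
  assumes "mono \<gamma>" "set a \<subseteq> {1..<n}" "set a' \<subseteq> {1..<n}" "hecke_word n a = hecke_word n a'"
  shows "foldl (block_act n \<gamma>) id a = foldl (block_act n \<gamma>) id a'"
proof (rule foldl_block_act_coarsen[of id])
  have "foldl (block_act n id) id b = inv (hecke_word n b)" if "set b \<subseteq> {1..<n}" for b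
    using foldl_block_act_inj[OF inj_on_id permutes_id that] foldl_lmul_inv[OF bij_id, of b]
      hecke_word_eq[OF that] by simp
  then show "foldl (block_act n id) id a = foldl (block_act n id) id a'"
    using assms by simp
qed (use assms in \<open>auto simp: mono_def\<close>)


section \<open>Comparison with the action on blocks\<close>

text \<open>Counting the block ends strictly before p yields the 0-based index of the block of p for
  p in {1..n}. In this form monotonicity holds on all of nat and refinement becomes inclusion of the
  counted sets.\<close>

definition color :: "nat list \<Rightarrow> nat \<Rightarrow> nat" where
  "color \<mu> p = card (partial_sums \<mu> \<inter> {..<p})"

lemma mono_color: "mono (color \<mu>)"
  by (auto simp: mono_def color_def intro!: card_mono)

lemma color_coarsen:
  assumes "refines \<nu> \<mu>" "color \<nu> x = color \<nu> y"
  shows "color \<mu> x = color \<mu> y"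
proof -
  have le: "color \<mu> x = color \<mu> y" if "x \<le> y" "color \<nu> x = color \<nu> y" for x y
  proof -
    \<comment> \<open>Nested finite sets of equal size agree: no end of a \<nu>-block separates x
      from y, hence no end of a \<mu>-block does.\<close>
    have "partial_sums \<nu> \<inter> {..<x} = partial_sums \<nu> \<inter> {..<y}"
      using that by (intro card_subset_eq) (auto simp: color_def)
    then have "partial_sums \<mu> \<inter> {..<x} = partial_sums \<mu> \<inter> {..<y}"
      using assms(1) unfolding refines_def by blast
    then show ?thesis by (simp add: color_def)
  qed
  show ?thesis
    using le[OF _ assms(2)] le[OF _ assms(2)[symmetric], symmetric] linear[of x y] by blast
qed

section \<open>Blocks as intervals of positions\<close>

lemma block_start_Suc: "r < length \<mu> \<Longrightarrow> block_start \<mu> (Suc r) = block_start \<mu> r + \<mu> ! r"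
  by (simp add: block_start_def take_Suc_conv_app_nth)

lemma block_start_less:
  assumes "\<forall>k\<in>set \<mu>. 0 < k" "i < j" "j \<le> length \<mu>"
  shows "block_start \<mu> i < block_start \<mu> j"
  using assms(2,3)
proof (induction j)
  case (Suc j)
  have "0 < \<mu> ! j" using assms(1) Suc.prems by simp
  then show ?case using Suc block_start_Suc[of j \<mu>] by (cases "i = j") auto
qed simp

lemma block_start_mono:
  assumes "\<forall>k\<in>set \<mu>. 0 < k" "i \<le> j" "j \<le> length \<mu>"
  shows "block_start \<mu> i \<le> block_start \<mu> j"
  using block_start_less[OF assms(1), of i j] assms(2,3) by (cases "i = j") auto

lemma color_eqI:
  assumes \<mu>: "\<forall>k\<in>set \<mu>. 0 < k" and r: "r < length \<mu>"
    and p: "block_start \<mu> r < p" "p \<le> block_start \<mu> r + \<mu> ! r"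
  shows "color \<mu> p = r"
proof -
  have "block_start \<mu> j < p \<longleftrightarrow> j \<le> r" if "j \<le> length \<mu>" for j
    using block_start_mono[OF \<mu>, of j r] block_start_mono[OF \<mu>, of "Suc r" j]
      block_start_Suc[OF r] that r p by (cases "j \<le> r") auto
  \<comment> \<open>With blocks numbered from 0, \<open>block_start \<mu> j\<close> is the end of
    block j - 1, so the ends before p are those for j from 1 to r.\<close>
  then have "partial_sums \<mu> \<inter> {..<p} = block_start \<mu> ` {1..r}"
    using r by (fastforce simp: partial_sums_def block_start_def)
  moreover have "inj_on (block_start \<mu>) {1..r}"
  proof (rule inj_onI)
    fix x y assume "x \<in> {1..r}" "y \<in> {1..r}" "block_start \<mu> x = block_start \<mu> y"
    then show "x = y"
      using block_start_less[OF \<mu>, of x y] block_start_less[OF \<mu>, of y x] r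
      by (cases x y rule: linorder_cases) auto
  qed
  ultimately show ?thesis by (simp add: color_def card_image)
qed

lemma block_exists:
  assumes "1 \<le> p" "p \<le> block_start \<mu> k" "k \<le> length \<mu>"
  shows "\<exists>r<length \<mu>. block_start \<mu> r < p \<and> p \<le> block_start \<mu> r + \<mu> ! r"
  using assms
proof (induction k)
  case 0
  then show ?case by (simp add: block_start_def)
next
  case (Suc k)
  then show ?case
    using block_start_Suc[of k \<mu>] by (cases "p \<le> block_start \<mu> k") (auto intro!: exI[of _ k])
qed

lemma block_start_length: "composition n \<mu> \<Longrightarrow> block_start \<mu> (length \<mu>) = n"
  by (simp add: block_start_def composition_def)

lemma color_bounds:
  assumes \<mu>: "composition n \<mu>" and p: "p \<in> {1..n}"
  shows "color \<mu> p < length \<mu>" "block_start \<mu> (color \<mu> p) < p"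
    "p \<le> block_start \<mu> (color \<mu> p) + \<mu> ! color \<mu> p"
proof -
  obtain r where r: "r < length \<mu>" "block_start \<mu> r < p" "p \<le> block_start \<mu> r + \<mu> ! r"
    using block_exists[of p \<mu> "length \<mu>"] p block_start_length[OF \<mu>] by auto
  have "color \<mu> p = r" by (rule color_eqI[OF _ r]) (use \<mu> in \<open>simp add: composition_def\<close>)
  then show "color \<mu> p < length \<mu>" "block_start \<mu> (color \<mu> p) < p"
    "p \<le> block_start \<mu> (color \<mu> p) + \<mu> ! color \<mu> p" using r by simp_all
qed

lemma color_eq_iff:
  assumes \<mu>: "composition n \<mu>" and p: "p \<in> {1..n}" and r: "r < length \<mu>"
  shows "color \<mu> p = r \<longleftrightarrow> block_start \<mu> r < p \<and> p \<le> block_start \<mu> r + \<mu> ! r"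
  using color_eqI[OF _ r, of p] color_bounds[OF \<mu> p] \<mu> by (auto simp: composition_def)

lemma block_le:
  assumes "composition n \<mu>" "r < length \<mu>"
  shows "block_start \<mu> r + \<mu> ! r \<le> n"
  using block_start_mono[of \<mu> "Suc r" "length \<mu>"] assms
  by (simp add: block_start_Suc block_start_length[OF assms(1)]) (simp add: composition_def)

lemma length_block [simp]: "length (block \<mu> \<pi> r) = \<mu> ! r"
  by (simp add: block_def)

lemma nth_map_upt_Suc: "j \<in> {1..m} \<Longrightarrow> map f [1..<Suc m] ! (j - 1) = f j"
  by (cases j) (auto simp del: upt_Suc)

lemma nth_block: "j \<in> {1..\<mu> ! r} \<Longrightarrow> block \<mu> \<pi> r ! (j - 1) = \<pi> (block_start \<mu> r + j)"
  unfolding block_def by (rule nth_map_upt_Suc)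

lemma set_block: "set (block \<mu> \<pi> r) = \<pi> ` {block_start \<mu> r + 1..block_start \<mu> r + \<mu> ! r}"
proof -
  have "{block_start \<mu> r + 1..block_start \<mu> r + \<mu> ! r} = (\<lambda>j. block_start \<mu> r + j) ` {1..\<mu> ! r}"
    by (simp add: add.commute)
  then show ?thesis
    by (simp only: block_def set_map set_upt image_image atLeastLessThanSuc_atLeastAtMost)
qed

text \<open>This gives the rank in V of an entry chosen by \<open>unstd\<close>. List indices start
  at 0 and ranks at 1.\<close>

lemma sorted_list_of_set_rank:
  assumes V: "finite V" and m: "m < card V"
  shows "sorted_list_of_set V ! m \<in> V" "card {v \<in> V. v \<le> sorted_list_of_set V ! m} = Suc m"
proof -
  let ?xs = "sorted_list_of_set V"
  have len: "length ?xs = card V" by simp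
  have set: "set ?xs = V" using V by simp
  have eq: "?xs ! i = ?xs ! j \<longleftrightarrow> i = j" if "i < card V" "j < card V" for i j
    using that len by (simp add: nth_eq_iff_index_eq)
  have le: "?xs ! i \<le> ?xs ! j" if "i \<le> j" "j < card V" for i j
    using that len by (simp add: sorted_nth_mono)
  show "?xs ! m \<in> V" using m set len nth_mem by metis
  have "{v \<in> V. v \<le> ?xs ! m} = (!) ?xs ` {..m}"
  proof (intro equalityI subsetI)
    fix v assume v: "v \<in> {v \<in> V. v \<le> ?xs ! m}"
    then have "v \<in> set ?xs" using V by simp
    then obtain t where t: "t < card V" "v = ?xs ! t"
      unfolding in_set_conv_nth len by blast
    have "t \<le> m"
      using le[of m t] eq[of m t] t m v by (cases "t \<le> m") auto
    then show "v \<in> (!) ?xs ` {..m}" using t by auto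
  next
    fix v assume "v \<in> (!) ?xs ` {..m}"
    then obtain t where t: "t \<le> m" "v = ?xs ! t" by auto
    have "v \<in> V" using t m set len nth_mem[of t ?xs] by simp
    then show "v \<in> {v \<in> V. v \<le> ?xs ! m}" using le[of t m] t m by simp
  qed
  moreover have "inj_on ((!) ?xs) {..m}" using eq m by (intro inj_onI) auto
  ultimately show "card {v \<in> V. v \<le> ?xs ! m} = Suc m" by (simp add: card_image)
qed

section \<open>Ranks and standardizations of the blocks of one permutation\<close>

context
  fixes n :: nat and \<mu> :: "nat list" and \<pi> :: "nat \<Rightarrow> nat"
  assumes \<mu>: "composition n \<mu>" and \<pi>: "\<pi> permutes {1..n}"
begin

lemma mem_block_iff:
  assumes r: "r < length \<mu>"
  shows "v \<in> set (block \<mu> \<pi> r) \<longleftrightarrow> v \<in> {1..n} \<and> (color \<mu> \<circ> inv \<pi>) v = r"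
proof
  assume "v \<in> set (block \<mu> \<pi> r)"
  then obtain p where p: "v = \<pi> p" "block_start \<mu> r < p" "p \<le> block_start \<mu> r + \<mu> ! r"
    unfolding set_block by auto
  then have "p \<in> {1..n}" using block_le[OF \<mu> r] by simp
  then show "v \<in> {1..n} \<and> (color \<mu> \<circ> inv \<pi>) v = r"
    using p color_eq_iff[OF \<mu> _ r, of p] permutes_in_image[OF \<pi>, of p] permutes_inverses(2)[OF \<pi>]
    by simp
next
  assume v: "v \<in> {1..n} \<and> (color \<mu> \<circ> inv \<pi>) v = r"
  then have "inv \<pi> v \<in> {1..n}" using permutes_in_image[OF permutes_inv[OF \<pi>], of v] by simp
  then have "inv \<pi> v \<in> {block_start \<mu> r + 1..block_start \<mu> r + \<mu> ! r}"
    using color_eq_iff[OF \<mu> _ r, of "inv \<pi> v"] v by simp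
  then have "\<pi> (inv \<pi> v) \<in> set (block \<mu> \<pi> r)" unfolding set_block by (rule imageI)
  then show "v \<in> set (block \<mu> \<pi> r)" using permutes_inverses(1)[OF \<pi>] by simp
qed

lemma color_less_length: "v \<in> {1..n} \<Longrightarrow> (color \<mu> \<circ> inv \<pi>) v < length \<mu>"
  using color_bounds(1)[OF \<mu>, of "inv \<pi> v"] permutes_in_image[OF permutes_inv[OF \<pi>], of v] by simp

lemma block_of_eq:
  assumes v: "v \<in> {1..n}"
  shows "block_of \<mu> \<pi> v = (color \<mu> \<circ> inv \<pi>) v"
  unfolding block_of_def
proof (rule the_equality)
  show "(color \<mu> \<circ> inv \<pi>) v < length \<mu> \<and> v \<in> set (block \<mu> \<pi> ((color \<mu> \<circ> inv \<pi>) v))"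
    using color_less_length[OF v] mem_block_iff v by simp
  show "r = (color \<mu> \<circ> inv \<pi>) v" if "r < length \<mu> \<and> v \<in> set (block \<mu> \<pi> r)" for r
    using that mem_block_iff[of r v] by simp
qed

text \<open>The rank first counts the values of smaller colour, which are as many as the positions
  before the block; what remains is the count inside the block.\<close>

lemma rank_block:
  assumes r: "r < length \<mu>" and v: "v \<in> set (block \<mu> \<pi> r)"
  shows "rank n (color \<mu> \<circ> inv \<pi>) v = block_start \<mu> r + card {w \<in> set (block \<mu> \<pi> r). w \<le> v}"
proof -
  have vn: "v \<in> {1..n}" and cv: "(color \<mu> \<circ> inv \<pi>) v = r" using v mem_block_iff[OF r] by auto
  let ?A = "{w \<in> {1..n}. (color \<mu> \<circ> inv \<pi>) w < r}" and ?B = "{w \<in> set (block \<mu> \<pi> r). w \<le> v}"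
  have "{w \<in> {1..n}. (color \<mu> \<circ> inv \<pi>) w < (color \<mu> \<circ> inv \<pi>) v
      \<or> (color \<mu> \<circ> inv \<pi>) w = (color \<mu> \<circ> inv \<pi>) v \<and> w \<le> v} = ?A \<union> ?B"
    using cv mem_block_iff[OF r] by auto
  moreover have "?A \<inter> ?B = {}" using mem_block_iff[OF r] by auto
  ultimately have "rank n (color \<mu> \<circ> inv \<pi>) v = card ?A + card ?B"
    using vn by (simp add: rank_def card_Un_disjoint)
  moreover have "card ?A = card {p \<in> {1..n}. color \<mu> p < r}"
    by (rule card_color[OF \<pi>])
  moreover have "{p \<in> {1..n}. color \<mu> p < r} = {1..block_start \<mu> r}"
  proof -
    have pos: "\<forall>k\<in>set \<mu>. 0 < k" using \<mu> by (simp add: composition_def)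
    have "color \<mu> p < r \<longleftrightarrow> p \<le> block_start \<mu> r" if p: "p \<in> {1..n}" for p
      using color_bounds[OF \<mu> p] block_start_mono[OF pos, of "Suc (color \<mu> p)" r]
        block_start_mono[OF pos, of r "color \<mu> p"] block_start_Suc[of "color \<mu> p" \<mu>] r
      by (cases "color \<mu> p < r") auto
    then show ?thesis using block_le[OF \<mu> r] by auto
  qed
  ultimately show ?thesis by simp
qed

text \<open>So \<pi> followed by \<open>rank\<close> is the juxtaposition of all the
  standardizations, each shifted to its block. This single permutation of {1..n} stands for the
  whole family in what follows.\<close>

lemma rank_std:
  assumes r: "r < length \<mu>" and j: "j \<in> {1..\<mu> ! r}"
  shows "rank n (color \<mu> \<circ> inv \<pi>) (\<pi> (block_start \<mu> r + j)) = block_start \<mu> r + std (block \<mu> \<pi> r) j"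
proof -
  have "\<pi> (block_start \<mu> r + j) \<in> set (block \<mu> \<pi> r)"
    unfolding set_block using j by (intro imageI) simp
  from rank_block[OF r this] show ?thesis
    using j nth_block[OF j, of \<pi>] by (simp add: std_def)
qed

lemma std_permutes:
  assumes r: "r < length \<mu>"
  shows "std (block \<mu> \<pi> r) permutes {1..\<mu> ! r}"
proof (rule bij_imp_permutes)
  let ?\<sigma> = "std (block \<mu> \<pi> r)"
  have "?\<sigma> j \<in> {1..\<mu> ! r}" if j: "j \<in> {1..\<mu> ! r}" for j
  proof -
    have mem: "block \<mu> \<pi> r ! (j - 1) \<in> set (block \<mu> \<pi> r)" using j by (intro nth_mem) auto
    then have "card {v \<in> set (block \<mu> \<pi> r). v \<le> block \<mu> \<pi> r ! (j - 1)} > 0"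
      by (intro card_gt_0_iff[THEN iffD2]) auto
    moreover have "card {v \<in> set (block \<mu> \<pi> r). v \<le> block \<mu> \<pi> r ! (j - 1)} \<le> card (set (block \<mu> \<pi> r))"
      by (rule card_mono) auto
    moreover have "card (set (block \<mu> \<pi> r)) \<le> \<mu> ! r" using card_length[of "block \<mu> \<pi> r"] by simp
    ultimately show ?thesis using j by (simp add: std_def)
  qed
  moreover have "inj_on ?\<sigma> {1..\<mu> ! r}"
  proof (rule inj_onI)
    fix x y assume xy: "x \<in> {1..\<mu> ! r}" "y \<in> {1..\<mu> ! r}" "?\<sigma> x = ?\<sigma> y"
    then have "rank n (color \<mu> \<circ> inv \<pi>) (\<pi> (block_start \<mu> r + x))
        = rank n (color \<mu> \<circ> inv \<pi>) (\<pi> (block_start \<mu> r + y))"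
      using rank_std[OF r] by simp
    then show "x = y"
      using permutes_inj[OF rank_permutes] permutes_inj[OF \<pi>] by (simp add: inj_eq)
  qed
  ultimately show "bij_betw ?\<sigma> {1..\<mu> ! r} {1..\<mu> ! r}"
    by (simp add: bij_betw_def endo_inj_surj image_subset_iff)
qed (auto simp: std_def)

lemma mu_involutionsI:
  assumes "rank n (color \<mu> \<circ> inv \<pi>) \<circ> \<pi> \<circ> (rank n (color \<mu> \<circ> inv \<pi>) \<circ> \<pi>) = id"
  shows "\<pi> \<in> mu_involutions n \<mu>"
  unfolding mu_involutions_def
proof (intro CollectI conjI allI impI)
  fix r assume r: "r < length \<mu>"
  let ?\<sigma> = "std (block \<mu> \<pi> r)"
  note \<sigma> = std_permutes[OF r]
  show "?\<sigma> \<circ> ?\<sigma> = id"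
  proof
    fix j show "(?\<sigma> \<circ> ?\<sigma>) j = id j"
    proof (cases "j \<in> {1..\<mu> ! r}")
      case True
      then have "?\<sigma> j \<in> {1..\<mu> ! r}" using permutes_in_image[OF \<sigma>] by blast
      then have "(rank n (color \<mu> \<circ> inv \<pi>) \<circ> \<pi>) ((rank n (color \<mu> \<circ> inv \<pi>) \<circ> \<pi>) (block_start \<mu> r + j))
          = block_start \<mu> r + ?\<sigma> (?\<sigma> j)"
        using rank_std[OF r True] rank_std[OF r, of "?\<sigma> j"] by simp
      then show ?thesis using fun_cong[OF assms, of "block_start \<mu> r + j"] by simp
    next
      case False
      then show ?thesis using permutes_not_in[OF \<sigma> False] by simp
    qed
  qed
qed (rule \<pi>)

text \<open>The map \<open>rank\<close> turns the swap of the values i, Suc i into that of J, Suc J.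
  The positions J and Suc J lie in the block containing i, and \<open>rank\<close> is increasing on
  values of one colour, so the position test is the same before and after applying it.\<close>

lemma rank_comp_block_act:
  assumes i: "i \<in> {1..<n}" and same: "(color \<mu> \<circ> inv \<pi>) i = (color \<mu> \<circ> inv \<pi>) (Suc i)"
  defines "J \<equiv> rank n (color \<mu> \<circ> inv \<pi>) i"
  shows "rank n (color \<mu> \<circ> inv \<pi>) \<circ> block_act n (color \<mu>) \<pi> i
    = rmul (lmul J (rank n (color \<mu> \<circ> inv \<pi>) \<circ> \<pi>)) J"
proof -
  let ?S = "rank n (color \<mu> \<circ> inv \<pi>)" and ?w = "lmul i \<pi>"
  have S: "bij ?S" using permutes_bij[OF rank_permutes] .
  have bp: "bij \<pi>" using permutes_bij[OF \<pi>] .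
  have SJ: "?S i = J" "?S (Suc i) = Suc J" using rank_Suc[of i n "color \<mu> \<circ> inv \<pi>"]
    i same by (simp_all add: J_def)
  have iSJ: "inv ?S J = i" "inv ?S (Suc J) = Suc i"
    using SJ bij_is_inj[OF S] by (metis inv_f_f)+
  have "?S \<circ> sref i = sref J \<circ> ?S" by (rule comp_sref_eq_sref_comp[OF S SJ])
  then have "?S \<circ> ?w = lmul J (?S \<circ> \<pi>)"
    by (simp add: lmul_def o_inv_distrib[OF S bp] iSJ comp_assoc[symmetric])
  moreover have "?S \<circ> rmul ?w J = rmul (?S \<circ> ?w) J"
  proof -
    have w: "?w permutes {1..n}" by (rule lmul_permutes[OF \<pi> i])
    have J: "J \<in> {1..<n}" unfolding J_def by (rule rank_in_less[OF i same])
    have cw: "color \<mu> \<circ> inv ?w = color \<mu> \<circ> inv \<pi>" by (rule color_lmul_eq[OF bp same])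
    have "color \<mu> J = (color \<mu> \<circ> inv \<pi>) i" "color \<mu> (Suc J) = (color \<mu> \<circ> inv \<pi>) i"
      using color_rank[OF \<pi> mono_color[of \<mu>], of i] color_rank[OF \<pi> mono_color[of \<mu>], of "Suc i"]
        SJ i same by simp_all
    moreover have "(color \<mu> \<circ> inv \<pi>) (?w p) = color \<mu> p" for p
      using fun_cong[OF cw, of "?w p"] permutes_inverses(2)[OF w] by simp
    ultimately have "(color \<mu> \<circ> inv \<pi>) (?w J) = (color \<mu> \<circ> inv \<pi>) (?w (Suc J))" by metis
    moreover have "?w J \<in> {1..n}" "?w (Suc J) \<in> {1..n}"
      using permutes_in_image[OF w, of J] permutes_in_image[OF w, of "Suc J"] J by simp_all
    ultimately have "?S (?w J) < ?S (?w (Suc J)) \<longleftrightarrow> ?w J < ?w (Suc J)"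
      using rank_less_iff[of "?w J" n "?w (Suc J)" "color \<mu> \<circ> inv \<pi>"] by simp
    then show ?thesis by (simp add: rmul_def comp_assoc)
  qed
  ultimately show ?thesis
    using same by (simp add: block_act_def Let_def J_def)
qed

end

section \<open>Agreement of the action on blocks with the action on colours\<close>

lemma lmul_shift:
  assumes \<sigma>: "\<sigma> permutes {1..b}" and z: "bij z" and zs: "\<forall>j\<in>{1..b}. z (s + j) = s + \<sigma> j"
    and k: "k \<in> {1..<b}"
  shows "j \<in> {1..b} \<Longrightarrow> lmul (s + k) z (s + j) = s + lmul k \<sigma> j"
    and "p \<notin> {s + 1..s + b} \<Longrightarrow> lmul (s + k) z p = z p"
proof -
  have iz: "inv z (s + x) = s + inv \<sigma> x" if "x \<in> {1..b}" for x
  proof -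
    have "inv \<sigma> x \<in> {1..b}" using permutes_in_image[OF permutes_inv[OF \<sigma>]] that by blast
    then have "z (s + inv \<sigma> x) = s + x" using zs permutes_inverses(1)[OF \<sigma>] by simp
    then show ?thesis using bij_is_inj[OF z] by (metis inv_f_f)
  qed
  have iff: "inv z (s + k) < inv z (Suc (s + k)) \<longleftrightarrow> inv \<sigma> k < inv \<sigma> (Suc k)"
    using iz[of k] iz[of "Suc k"] k by simp
  have sh: "sref (s + k) (s + x) = s + sref k x" for x by (simp add: transpose_def)
  show "lmul (s + k) z (s + j) = s + lmul k \<sigma> j" if "j \<in> {1..b}"
    using iff bspec[OF zs that] sh by (simp add: lmul_def)
  show "lmul (s + k) z p = z p" if p: "p \<notin> {s + 1..s + b}"
  proof -
    have "z p \<noteq> s + x" if x: "x \<in> {1..b}" for x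
    proof
      assume "z p = s + x"
      then have "p = inv z (s + x)" using bij_is_inj[OF z] by (metis inv_f_f)
      then have "p = s + inv \<sigma> x" using iz[OF x] by simp
      moreover have "inv \<sigma> x \<in> {1..b}" using permutes_in_image[OF permutes_inv[OF \<sigma>]] x by blast
      ultimately show False using p by simp
    qed
    from this[of k] this[of "Suc k"] show ?thesis using k by (simp add: lmul_def transpose_apply_other)
  qed
qed

lemma rmul_shift:
  assumes zs: "\<forall>j\<in>{1..b}. z (s + j) = s + \<sigma> j" and k: "k \<in> {1..<b}"
  shows "j \<in> {1..b} \<Longrightarrow> rmul z (s + k) (s + j) = s + rmul \<sigma> k j"
    and "p \<notin> {s + 1..s + b} \<Longrightarrow> rmul z (s + k) p = z p"
proof -
  have iff: "z (s + k) < z (Suc (s + k)) \<longleftrightarrow> \<sigma> k < \<sigma> (Suc k)"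
    using bspec[OF zs, of k] bspec[OF zs, of "Suc k"] k by simp
  have sh: "sref (s + k) (s + x) = s + sref k x" for x by (simp add: transpose_def)
  show "rmul z (s + k) (s + j) = s + rmul \<sigma> k j" if "j \<in> {1..b}"
    using iff bspec[OF zs that] bspec[OF zs, of "sref k j"] sh permutes_in_image[OF sref_permutes[OF k], of j] that
    by (simp add: rmul_def)
  show "rmul z (s + k) p = z p" if "p \<notin> {s + 1..s + b}"
    using that k by (auto simp: rmul_def transpose_def)
qed

lemma mu_act_eq:
  assumes \<mu>: "composition n \<mu>" and \<pi>: "\<pi> permutes {1..n}" and i: "i \<in> {1..<n}"
  shows "mu_act n \<mu> \<pi> i = block_act n (color \<mu>) \<pi> i"
proof -
  let ?c = "color \<mu> \<circ> inv \<pi>"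
  have bo: "block_of \<mu> \<pi> i = ?c i" "block_of \<mu> \<pi> (Suc i) = ?c (Suc i)"
    using block_of_eq[OF \<mu> \<pi>, of i] block_of_eq[OF \<mu> \<pi>, of "Suc i"] i by simp_all
  show ?thesis
  proof (cases "?c i = ?c (Suc i)")
    case False
    then show ?thesis
      using bo hecke_left_eq[OF \<pi> i] by (simp add: mu_act_def block_act_def Let_def)
  next
    case True
    define r where "r = ?c i"
    define s where "s = block_start \<mu> r"
    define b where "b = \<mu> ! r"
    define V where "V = set (block \<mu> \<pi> r)"
    define \<sigma> where "\<sigma> = std (block \<mu> \<pi> r)"
    define k where "k = card {v \<in> V. v \<le> i}"
    define \<sigma>' where "\<sigma>' = rmul (lmul k \<sigma>) k"
    let ?S = "rank n ?c"
    let ?z = "?S \<circ> \<pi>"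
    have r: "r < length \<mu>" unfolding r_def using color_less_length[OF \<mu> \<pi>, of i] i by simp
    have iV: "i \<in> V" "Suc i \<in> V"
      using mem_block_iff[OF \<mu> \<pi> r] True i by (auto simp: V_def r_def)
    have rank_V: "?S v = s + card {w \<in> V. w \<le> v}" if "v \<in> V" for v
      using rank_block[OF \<mu> \<pi> r] that by (simp add: V_def s_def)
    have cardV: "card V = b"
      unfolding V_def set_block by (simp add: card_image inj_on_subset[OF permutes_inj[OF \<pi>]] b_def)
    have finV: "finite V" by (simp add: V_def)
    have Si: "?S i = s + k" using rank_V[OF iV(1)] by (simp add: k_def)
    have k: "k \<in> {1..<b}"
    proof -
      have "card {w \<in> V. w \<le> Suc i} = Suc k"
        using rank_V[OF iV(2)] Si rank_Suc[of i n ?c] i True by simp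
      moreover have "card {w \<in> V. w \<le> Suc i} \<le> b"
        unfolding cardV[symmetric] by (rule card_mono[OF finV]) auto
      moreover have "k > 0" unfolding k_def using iV finV by (intro card_gt_0_iff[THEN iffD2]) auto
      ultimately show ?thesis by simp
    qed
    have \<sigma>: "\<sigma> permutes {1..b}" unfolding \<sigma>_def b_def by (rule std_permutes[OF \<mu> \<pi> r])
    have \<sigma>': "\<sigma>' permutes {1..b}"
      unfolding \<sigma>'_def by (intro rmul_permutes lmul_permutes \<sigma> k)
    have z: "bij ?z" by (intro bij_comp permutes_bij[OF \<pi>] permutes_bij[OF rank_permutes])
    have zs: "\<forall>j\<in>{1..b}. ?z (s + j) = s + \<sigma> j"
      using rank_std[OF \<mu> \<pi> r] by (simp add: s_def \<sigma>_def b_def)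
    have lzs: "\<forall>j\<in>{1..b}. lmul (s + k) ?z (s + j) = s + lmul k \<sigma> j"
      by (rule ballI) (rule lmul_shift(1)[OF \<sigma> z zs k])
    have ba: "?S \<circ> block_act n (color \<mu>) \<pi> i = rmul (lmul (s + k) ?z) (s + k)"
      using rank_comp_block_act[OF \<mu> \<pi> i True] Si by simp
    have "hecke_right b (hecke_left b k \<sigma>) k = \<sigma>'"
      using hecke_left_eq[OF \<sigma> k] hecke_right_eq[OF lmul_permutes[OF \<sigma> k] k] by (simp add: \<sigma>'_def)
    then have act: "mu_act n \<mu> \<pi> i = replace_block \<mu> \<pi> r (unstd V \<sigma>')"
      using bo True by (simp add: mu_act_def Let_def r_def V_def \<sigma>_def k_def b_def)
    \<comment> \<open>Both sides are compared after the injective map \<open>?S\<close>, under which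
      the word of block r becomes its shifted standardization.\<close>
    have "?S (mu_act n \<mu> \<pi> i p) = ?S (block_act n (color \<mu>) \<pi> i p)" for p
    proof (cases "p \<in> {s + 1..s + b}")
      case True
      define j where "j = p - s"
      have j: "j \<in> {1..b}" "p = s + j" using True by (auto simp: j_def)
      have m: "\<sigma>' j \<in> {1..b}" using permutes_in_image[OF \<sigma>'] j by blast
      have "unstd V \<sigma>' ! (p - s - 1) = sorted_list_of_set V ! (\<sigma>' j - 1)"
        using nth_map_upt_Suc[OF j(1), of "\<lambda>j. sorted_list_of_set V ! (\<sigma>' j - 1)"]
        unfolding unstd_def cardV j_def .
      then have "mu_act n \<mu> \<pi> i p = sorted_list_of_set V ! (\<sigma>' j - 1)"
        using True by (simp add: act replace_block_def s_def b_def)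
      moreover have "\<sigma>' j - 1 < card V" "Suc (\<sigma>' j - 1) = \<sigma>' j" using m cardV by auto
      \<comment> \<open>The entry with list index \<open>\<sigma>' j - 1\<close> is the value of
        rank \<open>\<sigma>' j\<close> in V.\<close>
      ultimately have "?S (mu_act n \<mu> \<pi> i p) = s + \<sigma>' j"
        using rank_V[of "sorted_list_of_set V ! (\<sigma>' j - 1)"]
          sorted_list_of_set_rank[OF finV, of "\<sigma>' j - 1"] by simp
      also have "\<dots> = rmul (lmul (s + k) ?z) (s + k) p"
        unfolding \<sigma>'_def j(2)
        by (rule rmul_shift(1)[OF lzs k j(1), symmetric])
      also have "\<dots> = ?S (block_act n (color \<mu>) \<pi> i p)" using fun_cong[OF ba, of p] by simp
      finally show ?thesis .
    next
      case False
      then have "mu_act n \<mu> \<pi> i p = \<pi> p" by (auto simp: act replace_block_def s_def b_def)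
      then have "?S (mu_act n \<mu> \<pi> i p) = ?z p" by simp
      also have "\<dots> = lmul (s + k) ?z p" by (rule lmul_shift(2)[OF \<sigma> z zs k False, symmetric])
      also have "\<dots> = rmul (lmul (s + k) ?z) (s + k) p"
        by (rule rmul_shift(2)[OF lzs k False, symmetric])
      also have "\<dots> = ?S (block_act n (color \<mu>) \<pi> i p)" using fun_cong[OF ba, of p] by simp
      finally show ?thesis .
    qed
    then show ?thesis using permutes_inj[OF rank_permutes] by (simp add: inj_eq fun_eq_iff)
  qed
qed

lemma foldl_mu_act:
  assumes \<mu>: "composition n \<mu>" and "\<pi> permutes {1..n}" "set a \<subseteq> {1..<n}"
  shows "foldl (mu_act n \<mu>) \<pi> a = foldl (block_act n (color \<mu>)) \<pi> a"
  using assms(2,3)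
proof (induction a arbitrary: \<pi>)
  case (Cons i a)
  then have i: "i \<in> {1..<n}" by simp
  show ?case
    using Cons mu_act_eq[OF \<mu> Cons.prems(1) i] block_act_permutes[OF Cons.prems(1) i] by simp
qed simp

lemma mu_act_word_eq:
  assumes "composition n \<mu>" "set a \<subseteq> {1..<n}"
  shows "mu_act_word n \<mu> id a = foldl (block_act n (color \<mu>)) id a"
  unfolding mu_act_word_def by (rule foldl_mu_act[OF assms(1) permutes_id assms(2)])

section \<open>Stability of \<mu>-involutions under the action\<close>

lemma involution_rmul_lmul:
  assumes z: "z \<circ> z = id"
  shows "rmul (lmul J z) J \<circ> rmul (lmul J z) J = id"
proof -
  have zz: "z (z x) = x" for x using fun_cong[OF z, of x] by simp
  have zz': "z \<circ> (z \<circ> f) = f" for f using z by (simp flip: comp_assoc)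
  have bz: "bij z" using o_bij[OF z z] .
  have iz: "inv z = z" using inv_unique_comp[OF z z] .
  show ?thesis
  proof (cases "z J < z (Suc J)")
    case False
    then show ?thesis using z by (simp add: lmul_def rmul_def iz)
  next
    case True
    then have l: "lmul J z = sref J \<circ> z" by (simp add: lmul_def iz)
    show ?thesis
    proof (cases "(sref J \<circ> z) J < (sref J \<circ> z) (Suc J)")
      case less: True
      then have "rmul (lmul J z) J = sref J \<circ> z \<circ> sref J" by (simp add: l rmul_def)
      then show ?thesis by (simp add: comp_assoc zz')
    next
      case False
      \<comment> \<open>Swapping the values J, Suc J can destroy the ascent of z at the positions J,
        Suc J only if its two entries there are these values. Then z fixes both and commutes with
        the swap.\<close>
      then have "z J = J" "z (Suc J) = Suc J"
        using True sref_less_iff[of "z J" J "z (Suc J)"] by auto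
      then have "z \<circ> sref J = sref J \<circ> z" by (rule comp_sref_eq_sref_comp[OF bz])
      moreover have "rmul (lmul J z) J = sref J \<circ> z" using False by (simp add: l rmul_def)
      ultimately show ?thesis using zz' by (metis comp_assoc sref_comp_sref(2) z)
    qed
  qed
qed

text \<open>Inside a block, \<open>rank_comp_block_act\<close> reduces the claim to
  \<open>involution_rmul_lmul\<close>. Across blocks the juxtaposed standardizations do not change
  at all.\<close>

lemma involution_block_act:
  assumes \<mu>: "composition n \<mu>" and \<pi>: "\<pi> permutes {1..n}" and i: "i \<in> {1..<n}"
    and inv: "rank n (color \<mu> \<circ> inv \<pi>) \<circ> \<pi> \<circ> (rank n (color \<mu> \<circ> inv \<pi>) \<circ> \<pi>) = id"
  defines "\<rho> \<equiv> block_act n (color \<mu>) \<pi> i"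
  shows "rank n (color \<mu> \<circ> inv \<rho>) \<circ> \<rho> \<circ> (rank n (color \<mu> \<circ> inv \<rho>) \<circ> \<rho>) = id"
proof (cases "(color \<mu> \<circ> inv \<pi>) i = (color \<mu> \<circ> inv \<pi>) (Suc i)")
  case True
  have "color \<mu> \<circ> inv \<rho> = color \<mu> \<circ> inv \<pi>"
    unfolding \<rho>_def by (rule color_block_act[OF \<pi> mono_color i True])
  then show ?thesis
    using rank_comp_block_act[OF \<mu> \<pi> i True] involution_rmul_lmul[OF inv] by (simp add: \<rho>_def)
next
  case False
  let ?c = "color \<mu> \<circ> inv \<pi>"
  have \<rho>: "\<rho> = lmul i \<pi>" using False by (simp add: \<rho>_def block_act_def)
  have "rank n (?c \<circ> sref i) \<circ> (sref i \<circ> \<pi>) = rank n ?c \<circ> \<pi>"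
    unfolding rank_comp_sref[of i n ?c, OF i False] by (simp add: comp_assoc)
  moreover note lmul_color_neq[OF mono_color permutes_bij[OF \<pi>] False]
  ultimately have "rank n (color \<mu> \<circ> inv \<rho>) \<circ> \<rho> = rank n ?c \<circ> \<pi>"
    unfolding \<rho> by (cases "?c i < ?c (Suc i)") (simp_all only: if_True if_False)
  then show ?thesis using inv by simp
qed

lemma mu_act_word_mu_involutions:
  assumes \<mu>: "composition n \<mu>" and a: "set a \<subseteq> {1..<n}"
  shows "mu_act_word n \<mu> id a \<in> mu_involutions n \<mu>"
proof -
  define I where "I \<pi> \<longleftrightarrow> \<pi> permutes {1..n} \<and>
    rank n (color \<mu> \<circ> inv \<pi>) \<circ> \<pi> \<circ> (rank n (color \<mu> \<circ> inv \<pi>) \<circ> \<pi>) = id" for \<pi>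
  have "I (block_act n (color \<mu>) \<pi> i)" if "I \<pi>" "i \<in> {1..<n}" for \<pi> i
    using that involution_block_act[OF \<mu> _ that(2)] block_act_permutes[OF _ that(2)]
    by (simp add: I_def)
  then have "I \<pi> \<Longrightarrow> I (foldl (block_act n (color \<mu>)) \<pi> a)" for \<pi>
    using a by (induction a arbitrary: \<pi>) simp_all
  moreover have "I id" by (simp add: I_def permutes_id rank_mono_eq_id[OF mono_color])
  ultimately have "I (mu_act_word n \<mu> id a)" unfolding mu_act_word_eq[OF \<mu> a] by blast
  then show ?thesis using mu_involutionsI[OF \<mu>] by (simp add: I_def)
qed

section \<open>From words to permutations\<close>

lemma mu_act_perm_hecke_word:
  assumes \<mu>: "composition n \<mu>" and a: "set a \<subseteq> {1..<n}"
  shows "mu_act_perm n \<mu> id (hecke_word n a) = mu_act_word n \<mu> id a"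
  unfolding mu_act_perm_def
proof (rule the_equality)
  show "\<exists>b. set b \<subseteq> {1..<n} \<and> hecke_word n b = hecke_word n a \<and> mu_act_word n \<mu> id b = mu_act_word n \<mu> id a"
    using a by blast
next
  fix \<rho>
  assume "\<exists>b. set b \<subseteq> {1..<n} \<and> hecke_word n b = hecke_word n a \<and> mu_act_word n \<mu> id b = \<rho>"
  then obtain b where b: "set b \<subseteq> {1..<n}" "hecke_word n b = hecke_word n a" "mu_act_word n \<mu> id b = \<rho>"
    by blast
  then show "\<rho> = mu_act_word n \<mu> id a"
    using foldl_block_act_hecke_word[OF mono_color b(1) a b(2), of \<mu>]
      mu_act_word_eq[OF \<mu> a] mu_act_word_eq[OF \<mu> b(1)] by simp
qed

lemma permutes_reduced_word:
  assumes "w permutes {1..n}"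
  obtains a where "set a \<subseteq> {1..<n}" "hecke_word n a = w" "length a = coxeter_length n w"
proof -
  obtain a where "set a \<subseteq> {1..<n}" "length a = card (inversions n w)" "foldl rmul id a = w"
    using reduced_word[OF assms] by blast
  then show ?thesis
    using that[of a] hecke_word_eq[of a n] coxeter_length_eq[OF assms] by simp
qed

lemma hecke_word_permutes: "set a \<subseteq> {1..<n} \<Longrightarrow> hecke_word n a permutes {1..n}"
  using foldl_rmul_permutes[OF permutes_id] by (simp add: hecke_word_eq)

lemma coxeter_length_hecke_word:
  assumes a: "set a \<subseteq> {1..<n}"
  shows "coxeter_length n (hecke_word n a) \<le> length a"
  using coxeter_length_eq[OF hecke_word_permutes[OF a]] hecke_word_eq[OF a]
    card_inversions_foldl_rmul[OF permutes_id a] by simp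

section \<open>Atoms\<close>

text \<open>A word leading to \<pi> is at least as long as the Coxeter length of its 0-Hecke
  product, and a reduced word attains that length. So, when some permutation yields \<pi>,
  \<open>mu_length\<close> is the least Coxeter length in the fibre over \<pi>; otherwise both sets
  are empty.\<close>

lemma atoms_eq_minimal:
  assumes \<mu>: "composition n \<mu>"
  shows "atoms n \<mu> \<pi> = {w. w permutes {1..n} \<and> mu_act_perm n \<mu> id w = \<pi> \<and>
    (\<forall>u. u permutes {1..n} \<and> mu_act_perm n \<mu> id u = \<pi> \<longrightarrow> coxeter_length n w \<le> coxeter_length n u)}"
proof -
  have "coxeter_length n w = mu_length n \<mu> \<pi> \<longleftrightarrow>
      (\<forall>u. u permutes {1..n} \<and> mu_act_perm n \<mu> id u = \<pi> \<longrightarrow> coxeter_length n w \<le> coxeter_length n u)"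
    if w: "w permutes {1..n}" "mu_act_perm n \<mu> id w = \<pi>" for w
  proof -
    let ?P = "\<lambda>p. \<exists>a. length a = p \<and> set a \<subseteq> {1..<n} \<and> mu_act_word n \<mu> id a = \<pi>"
    have P: "?P (coxeter_length n u)" if u: "u permutes {1..n}" "mu_act_perm n \<mu> id u = \<pi>" for u
    proof -
      obtain a where "set a \<subseteq> {1..<n}" "hecke_word n a = u" "length a = coxeter_length n u"
        using permutes_reduced_word[OF u(1)] .
      then show ?thesis using mu_act_perm_hecke_word[OF \<mu>] u(2) by metis
    qed
    have le: "mu_length n \<mu> \<pi> \<le> coxeter_length n u"
      if "u permutes {1..n}" "mu_act_perm n \<mu> id u = \<pi>" for u
      unfolding mu_length_def by (rule Least_le[of ?P]) (rule P[OF that])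
    have "?P (mu_length n \<mu> \<pi>)"
      unfolding mu_length_def by (rule LeastI[of ?P]) (rule P[OF w])
    then obtain a where a: "length a = mu_length n \<mu> \<pi>" "set a \<subseteq> {1..<n}" "mu_act_word n \<mu> id a = \<pi>"
      by blast
    then have "hecke_word n a permutes {1..n}" "mu_act_perm n \<mu> id (hecke_word n a) = \<pi>"
      "coxeter_length n (hecke_word n a) \<le> mu_length n \<mu> \<pi>"
      using hecke_word_permutes mu_act_perm_hecke_word[OF \<mu>] coxeter_length_hecke_word[OF a(2)]
      by simp_all
    then show ?thesis using le w by (metis le_antisym le_trans)
  qed
  then show ?thesis unfolding atoms_def by blast
qed

text \<open>After choosing reduced words, equality of the \<nu>-states passes to the \<mu>-states by
  \<open>foldl_block_act_coarsen\<close>, with \<open>color_coarsen\<close> providing the nesting of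
  the colourings.\<close>

lemma mu_act_perm_coarsen:
  assumes \<mu>: "composition n \<mu>" and \<nu>: "composition n \<nu>" and ref: "refines \<nu> \<mu>"
    and u: "u permutes {1..n}" and w: "w permutes {1..n}"
    and eq: "mu_act_perm n \<nu> id u = mu_act_perm n \<nu> id w"
  shows "mu_act_perm n \<mu> id u = mu_act_perm n \<mu> id w"
proof -
  obtain a where a: "set a \<subseteq> {1..<n}" "hecke_word n a = u" by (rule permutes_reduced_word[OF u])
  obtain b where b: "set b \<subseteq> {1..<n}" "hecke_word n b = w" by (rule permutes_reduced_word[OF w])
  have "foldl (block_act n (color \<mu>)) id a = foldl (block_act n (color \<mu>)) id b"
  proof (rule foldl_block_act_coarsen[OF mono_color mono_color color_coarsen[OF ref] a(1) b(1)])
    show "foldl (block_act n (color \<nu>)) id a = foldl (block_act n (color \<nu>)) id b"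
      using eq mu_act_perm_hecke_word[OF \<nu> a(1)] mu_act_perm_hecke_word[OF \<nu> b(1)]
        mu_act_word_eq[OF \<nu> a(1)] mu_act_word_eq[OF \<nu> b(1)] a(2) b(2) by simp
  qed
  then show ?thesis
    using mu_act_perm_hecke_word[OF \<mu> a(1)] mu_act_perm_hecke_word[OF \<mu> b(1)]
      mu_act_word_eq[OF \<mu> a(1)] mu_act_word_eq[OF \<mu> b(1)] a(2) b(2) by simp
qed

theorem theorem3p7:
  fixes n :: nat and \<mu> \<nu> :: "nat list" and \<pi> :: "nat \<Rightarrow> nat"
  assumes "composition n \<mu>" and "composition n \<nu>" and "refines \<nu> \<mu>"
    and "\<pi> \<in> mu_involutions n \<mu>"
  shows "mu_schubert n \<mu> \<pi>
    = (\<Sum>\<tau>\<in>{\<tau> \<in> mu_involutions n \<nu>. atom_le n \<nu> \<mu> \<tau> \<pi>}. mu_schubert n \<nu> \<tau>)"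
proof -
  let ?T = "{\<tau> \<in> mu_involutions n \<nu>. atom_le n \<nu> \<mu> \<tau> \<pi>}"
  have fin: "finite {w :: nat \<Rightarrow> nat. w permutes {1..n}}" by (simp add: finite_permutations)
  have "finite ?T" by (rule finite_subset[OF _ fin]) (auto simp: mu_involutions_def)
  moreover have "\<forall>\<tau>\<in>?T. finite (atoms n \<nu> \<tau>)"
    by (intro ballI finite_subset[OF _ fin]) (auto simp: atoms_def)
  \<comment> \<open>A permutation determines the \<nu>-state it produces from the identity, so it is
    an atom of at most one \<tau>.\<close>
  moreover have "\<forall>\<tau>\<in>?T. \<forall>\<tau>'\<in>?T. \<tau> \<noteq> \<tau>' \<longrightarrow> atoms n \<nu> \<tau> \<inter> atoms n \<nu> \<tau>' = {}"
    by (auto simp: atoms_def)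
  ultimately have "(\<Sum>w\<in>(\<Union>\<tau>\<in>?T. atoms n \<nu> \<tau>). schubert n w) = (\<Sum>\<tau>\<in>?T. mu_schubert n \<nu> \<tau>)"
    unfolding mu_schubert_def by (rule sum.UNION_disjoint)
  moreover have "(\<Union>\<tau>\<in>?T. atoms n \<nu> \<tau>) = atoms n \<mu> \<pi>"
  proof
    show "(\<Union>\<tau>\<in>?T. atoms n \<nu> \<tau>) \<subseteq> atoms n \<mu> \<pi>" by (auto simp: atom_le_def)
    show "atoms n \<mu> \<pi> \<subseteq> (\<Union>\<tau>\<in>?T. atoms n \<nu> \<tau>)"
    proof
      fix w assume w: "w \<in> atoms n \<mu> \<pi>"
      \<comment> \<open>The only summand that can contain w is the one indexed by its own
        \<nu>-state.\<close>
      define \<tau> where "\<tau> = mu_act_perm n \<nu> id w"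
      have wn: "w permutes {1..n}" and w\<pi>: "mu_act_perm n \<mu> id w = \<pi>" using w by (auto simp: atoms_def)
      have w_min: "coxeter_length n w \<le> coxeter_length n u"
        if "u permutes {1..n}" "mu_act_perm n \<mu> id u = \<pi>" for u
        using w that unfolding atoms_eq_minimal[OF assms(1)] by blast
      have coarse: "mu_act_perm n \<mu> id u = \<pi>"
        if "u permutes {1..n}" "mu_act_perm n \<nu> id u = \<tau>" for u
        using mu_act_perm_coarsen[OF assms(1-3) that(1) wn] that(2) w\<pi> by (simp add: \<tau>_def)
      \<comment> \<open>The length of w is minimal over the \<mu>-fibre of \<pi>, hence over the
        \<nu>-fibre of \<tau> contained in it.\<close>
      have "w \<in> atoms n \<nu> \<tau>"
        unfolding atoms_eq_minimal[OF assms(2)] using wn w_min coarse by (auto simp: \<tau>_def)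
      \<comment> \<open>Every atom of \<tau> is no longer than w and lies in the \<mu>-fibre of
        \<pi>, so it is minimal there as well.\<close>
      moreover have "atoms n \<nu> \<tau> \<subseteq> atoms n \<mu> \<pi>"
      proof
        fix u assume u: "u \<in> atoms n \<nu> \<tau>"
        then have un: "u permutes {1..n}" "mu_act_perm n \<nu> id u = \<tau>" by (auto simp: atoms_def)
        have "coxeter_length n u \<le> coxeter_length n w"
          using u wn unfolding atoms_eq_minimal[OF assms(2)] by (auto simp: \<tau>_def)
        then show "u \<in> atoms n \<mu> \<pi>"
          unfolding atoms_eq_minimal[OF assms(1)]
          using un coarse[OF un] w_min le_trans by blast
      qed
      moreover have "\<tau> \<in> mu_involutions n \<nu>"
      proof -
        obtain a where "set a \<subseteq> {1..<n}" "hecke_word n a = w" by (rule permutes_reduced_word[OF wn])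
        then show ?thesis
          using mu_act_word_mu_involutions[OF assms(2)] mu_act_perm_hecke_word[OF assms(2)]
          by (metis \<tau>_def)
      qed
      ultimately show "w \<in> (\<Union>\<tau>\<in>?T. atoms n \<nu> \<tau>)" using assms(3) by (auto simp: atom_le_def)
    qed
  qed
  ultimately show ?thesis by (simp add: mu_schubert_def)
qed

end
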